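(* Let $q$ be a prime power, $m\geq 2$ and $r\geq 2$ integers, $\lambda$ a non-zero integer with $\gcd(r\lambda,m)=1$ and $\gcd(m,q)=1$, and $\alpha_1,\dots,\alpha_r\in\mathbb{F}_q$ pairwise distinct. Let $F=\mathbb{F}_q(x,y)$ with $y^m=\prod_{i=1}^r(x-\alpha_i)^\lambda$. Let $Q_\infty$ be the unique place of $F$ over the pole of $x$, and $Q_i$ the unique place of $F$ over the zero of $x-\alpha_i$ ($1\leq i\leq r$). Suppose that $r+1\leq q$. For $1\leq s\leq r-\left\lfloor\frac{r}{m}\right\rfloor-1$, the set $\Gamma(Q_\infty,Q_1,\dots,Q_s)$ is $$\left\{(mj_0-ir,\,mj_1+i,\dots,mj_s+i)\in\mathbb{N}^{s+1}\;\Big|\;1\leq i\leq m-1-\left\lfloor\frac{m}{r}\right\rfloor,\ j_0\geq\left\lceil\frac{ir}{m}\right\rceil,\ j_k\geq 0\ (1\leq k\leq s),\ \sum_{k=0}^s j_k=r-s\right\},$$ where $i,j_0,\dots,j_s$ are integers, and $\Gamma(Q_\infty,Q_1,\dots,Q_s)=\varnothing$ for $r-\left\lfloor\frac{r}{m}\right\rfloor-1<s\leq r$.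
   Context: $\mathbb{N}=\{1,2,\dots\}$, $\mathbb{N}_0=\mathbb{N}\cup\{0\}$, and $(z)_\infty$ denotes the pole divisor of $z$. For $t\geq2$ distinct rational (degree one) places $R_1,\dots,R_t$ of $F$, $H(R_1,\dots,R_t)=\{(n_1,\dots,n_t)\in\mathbb{N}_0^t:\exists z\in F,\ (z)_\infty=\sum n_iR_i\}$. With the componentwise partial order $\preceq$ on $\mathbb{N}_0^t$ (an element $\mathbf a$ of a set $S$ is minimal in $S$ if $\mathbf b\not\preceq\mathbf a$ for all $\mathbf b\in S\setminus\{\mathbf a\}$), $\Gamma(R_1,\dots,R_t)$ is the set of all $\mathbf a=(a_1,\dots,a_t)\in\mathbb{N}^t$ such that, for some $1\leq i\leq t$, $\mathbf a$ is minimal in $\{\mathbf n\in H(R_1,\dots,R_t): n_i=a_i\}$. The places $Q_\infty,Q_1,\dots,Q_r$ are totally ramified over $\mathbb{F}_q(x)$ and rational. *)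

theory Defs
  imports
    "HOL-Computational_Algebra.Computational_Algebra"
    "HOL-Number_Theory.Number_Theory"
begin

text \<open>
  All fields are subsets of one ambient field \<open>'a\<close>: \<open>K\<close> is the constant field and \<open>F\<close> an
  algebraic function field in one variable over \<open>K\<close>.  Valuation rings, places, valuations and
  pole divisors follow Stichtenoth, Algebraic Function Fields and Codes, Chapter 1.
\<close>

definition is_ring_hom :: "('k::ring_1 \<Rightarrow> 'a::ring_1) \<Rightarrow> bool" where
  "is_ring_hom h \<longleftrightarrow> h 1 = 1 \<and> (\<forall>a b. h (a + b) = h a + h b) \<and> (\<forall>a b. h (a * b) = h a * h b)"

definition transcendental_over :: "('k::field \<Rightarrow> 'a::field) \<Rightarrow> 'a \<Rightarrow> bool" where
  "transcendental_over emb x \<longleftrightarrow> (\<forall>p. p \<noteq> 0 \<longrightarrow> poly (map_poly emb p) x \<noteq> 0)"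

definition is_subring :: "'a::field set \<Rightarrow> bool" where
  "is_subring R \<longleftrightarrow> 1 \<in> R \<and> (\<forall>a\<in>R. \<forall>b\<in>R. a - b \<in> R) \<and> (\<forall>a\<in>R. \<forall>b\<in>R. a * b \<in> R)"

definition is_subfield :: "'a::field set \<Rightarrow> bool" where
  "is_subfield L \<longleftrightarrow> is_subring L \<and> (\<forall>a\<in>L. inverse a \<in> L)"

definition field_generated :: "'a::field set \<Rightarrow> 'a set" where
  "field_generated A = \<Inter> {L. is_subfield L \<and> A \<subseteq> L}"

definition is_ideal :: "'a::field set \<Rightarrow> 'a set \<Rightarrow> bool" where
  "is_ideal R I \<longleftrightarrow> 0 \<in> I \<and> I \<subseteq> R \<and> (\<forall>a\<in>I. \<forall>b\<in>I. a - b \<in> I) \<and> (\<forall>a\<in>R. \<forall>b\<in>I. a * b \<in> I)"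

definition is_maximal_ideal :: "'a::field set \<Rightarrow> 'a set \<Rightarrow> bool" where
  "is_maximal_ideal R I \<longleftrightarrow>
     is_ideal R I \<and> I \<noteq> R \<and> (\<forall>J. is_ideal R J \<and> I \<subseteq> J \<longrightarrow> J = I \<or> J = R)"

text \<open>Both inclusions are strict; in the last clause \<open>z = 0\<close> is harmless since \<open>0 \<in> R\<close>.\<close>

definition is_valuation_ring :: "'a::field set \<Rightarrow> 'a set \<Rightarrow> 'a set \<Rightarrow> bool" where
  "is_valuation_ring K F R \<longleftrightarrow>
     is_subring R \<and> K \<subset> R \<and> R \<subset> F \<and> (\<forall>z\<in>F. z \<in> R \<or> inverse z \<in> R)"

definition is_place :: "'a::field set \<Rightarrow> 'a set \<Rightarrow> 'a set \<Rightarrow> bool" where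
  "is_place K F P \<longleftrightarrow> (\<exists>R. is_valuation_ring K F R \<and> is_maximal_ideal R P)"

text \<open>
  The valuation ring \<open>\<O>\<^sub>P = {z \<in> F. z\<^sup>-\<^sup>1 \<notin> P}\<close> of a place.  As \<open>inverse 0 = 0\<close> lies in \<open>P\<close>,
  the element \<open>0\<close> has to be added by hand.
\<close>

definition place_ring :: "'a::field set \<Rightarrow> 'a set \<Rightarrow> 'a set" where
  "place_ring F P = {z \<in> F. z = 0 \<or> inverse z \<notin> P}"

definition place_units :: "'a::field set \<Rightarrow> 'a set \<Rightarrow> 'a set" where
  "place_units F P = {u \<in> place_ring F P. u \<noteq> 0 \<and> inverse u \<in> place_ring F P}"

text \<open>
  The discrete valuation \<open>v\<^sub>P\<close>: writing \<open>P = t \<O>\<^sub>P\<close>, every \<open>z \<noteq> 0\<close> in \<open>F\<close> is \<open>t\<^sup>n u\<close> with a unit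
  \<open>u\<close> and an integer \<open>n\<close> that does not depend on the choice of \<open>t\<close>.  Not meaningful at \<open>z = 0\<close>.
\<close>

definition place_val :: "'a::field set \<Rightarrow> 'a set \<Rightarrow> 'a \<Rightarrow> int" where
  "place_val F P z =
     (THE n. \<exists>t u. P = (\<lambda>w. t * w) ` place_ring F P \<and> u \<in> place_units F P \<and> z = (t powi n) * u)"

text \<open>The place \<open>Q\<close> of the larger field lies over the place \<open>P\<close> of the smaller field.\<close>

definition lies_over :: "'a set \<Rightarrow> 'a set \<Rightarrow> bool" where
  "lies_over Q P \<longleftrightarrow> P \<subseteq> Q"

text \<open>Divisors are functions from places to integers; they are \<open>0\<close> on sets that are not places.\<close>

definition pole_divisor :: "'a::field set \<Rightarrow> 'a set \<Rightarrow> 'a \<Rightarrow> 'a set \<Rightarrow> int" where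
  "pole_divisor K F z =
     (\<lambda>P. if is_place K F P \<and> place_val F P z < 0 then - place_val F P z else 0)"

definition divisor_of :: "'a set list \<Rightarrow> nat list \<Rightarrow> 'a set \<Rightarrow> int" where
  "divisor_of Rs ns = (\<lambda>P. \<Sum>k<length Rs. if P = Rs ! k then int (ns ! k) else 0)"

text \<open>
  Tuples \<open>(n\<^sub>1, \<dots>, n\<^sub>t)\<close> are lists of length \<open>t\<close>, indexed from \<open>0\<close>.  In the next definition \<open>z = 0\<close>
  is excluded because it has no divisor; the zero tuple still belongs to the set, by \<open>z = 1\<close>.
\<close>

definition weierstrass_semigroup ::
    "'a::field set \<Rightarrow> 'a set \<Rightarrow> 'a set list \<Rightarrow> nat list set" where
  "weierstrass_semigroup K F Rs =
     {ns. length ns = length Rs \<and> (\<exists>z\<in>F. z \<noteq> 0 \<and> pole_divisor K F z = divisor_of Rs ns)}"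

definition is_minimal_in :: "nat list \<Rightarrow> nat list set \<Rightarrow> bool" where
  "is_minimal_in a S \<longleftrightarrow> a \<in> S \<and> (\<forall>b \<in> S - {a}. \<not> list_all2 (\<le>) b a)"

definition minimal_generating_set ::
    "'a::field set \<Rightarrow> 'a set \<Rightarrow> 'a set list \<Rightarrow> nat list set" where
  "minimal_generating_set K F Rs =
     {a. length a = length Rs \<and> (\<forall>k<length Rs. 0 < a ! k) \<and>
         (\<exists>i<length Rs. is_minimal_in a {ns \<in> weierstrass_semigroup K F Rs. ns ! i = a ! i})}"

end

theory Submission
  imports Defs
begin

hide_const (open) UnivPoly.coeff UnivPoly.monom Module.smult Coset.order

text \<open>
  After replacing \<open>y\<close> the curve is \<open>y\<^sup>m = f(x)\<close> with \<open>f = \<Prod>\<^sub>i (x - \<alpha>\<^sub>i)\<close>.  At the totally ramified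
  places the summands \<open>f\<^sub>i(x) y\<^sup>i\<close>, \<open>0 \<le> i < m\<close>, of a function have pairwise distinct orders, so the
  pole vector of a function is the least upper bound of the pole vectors of its summands.  As
  \<open>K[x, y]\<close> is integrally closed, a function with poles only in \<open>Q\<^sub>\<infinity>, Q\<^sub>1, \<dots>, Q\<^sub>s\<close> becomes an
  element of \<open>K[x, y]\<close> after multiplication by a power of \<open>(x - \<alpha>\<^sub>1)\<dots>(x - \<alpha>\<^sub>s)\<close>; hence its summands
  again have poles only there.  A minimal pole vector therefore belongs to a single summand
  \<open>g(x) y\<^sup>i\<close>, and minimality forces it to be \<open>y\<^sup>i / \<Prod>\<^sub>k (x - \<alpha>\<^sub>k)\<^bsup>e k\<^esup>\<close>.  Conversely, the pole order of
  such a monomial at \<open>Q\<^sub>\<infinity>\<close> determines \<open>i\<close> modulo \<open>m\<close>, and comparing degrees shows that no other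
  function with the same pole order there has smaller poles at the \<open>Q\<^sub>k\<close>.
\<close>


section \<open>Subrings and valuation rings\<close>

text \<open>A pole divisor ranges over all places of F, and \<open>place_val\<close> is a definite
  description that determines nothing until a uniformizer is known. Discreteness is therefore proved
  at every place, also where no explicit orders are at hand. There finiteness of the constant field
  and coprimality of m and q enter: modulo a prime p of K[x] not dividing f the ring K[x, y] is
  finite and, by a Frobenius argument, reduced, which makes such a p in the maximal ideal a
  uniformizer. The same reducedness cancels p from denominators in the proof of integral closedness;
  for the prime factors of f the explicit orders do this. Nor is F assumed to have degree m over
  K(x): independence of the powers of y up to m - 1 is read off from the orders at one totally
  ramified place. Finally, the given places are described by the sign of a valuation of K(x);
  discreteness there is the same result with m = 1.\<close>

lemma subring_zero: "is_subring R \<Longrightarrow> 0 \<in> R"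
  unfolding is_subring_def by (metis diff_self)

lemma subring_one: "is_subring R \<Longrightarrow> 1 \<in> R"
  by (simp add: is_subring_def)

lemma subring_diff: "is_subring R \<Longrightarrow> a \<in> R \<Longrightarrow> b \<in> R \<Longrightarrow> a - b \<in> R"
  by (simp add: is_subring_def)

lemma subring_mult: "is_subring R \<Longrightarrow> a \<in> R \<Longrightarrow> b \<in> R \<Longrightarrow> a * b \<in> R"
  by (simp add: is_subring_def)

lemma subring_uminus: "is_subring R \<Longrightarrow> a \<in> R \<Longrightarrow> - a \<in> R"
  using subring_diff[OF _ subring_zero] by fastforce

lemma subring_add: "is_subring R \<Longrightarrow> a \<in> R \<Longrightarrow> b \<in> R \<Longrightarrow> a + b \<in> R"
  using subring_diff[of R a "- b"] subring_uminus[of R b] by simp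

lemma subring_power: "is_subring R \<Longrightarrow> a \<in> R \<Longrightarrow> a ^ n \<in> R"
  by (induction n) (auto intro: subring_one subring_mult)

lemma subring_sum: "is_subring R \<Longrightarrow> (\<And>i. i \<in> I \<Longrightarrow> g i \<in> R) \<Longrightarrow> sum g I \<in> R"
  by (induction I rule: infinite_finite_induct) (auto intro: subring_zero subring_add)

lemma subring_prod: "is_subring R \<Longrightarrow> (\<And>i. i \<in> I \<Longrightarrow> g i \<in> R) \<Longrightarrow> prod g I \<in> R"
  by (induction I rule: infinite_finite_induct) (auto intro: subring_one subring_mult)

lemma subfield_powi: "is_subfield L \<Longrightarrow> a \<in> L \<Longrightarrow> a powi n \<in> L"
  unfolding is_subfield_def power_int_def by (auto intro: subring_power)

lemma subfield_divide: "is_subfield L \<Longrightarrow> a \<in> L \<Longrightarrow> b \<in> L \<Longrightarrow> a / b \<in> L"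
  unfolding is_subfield_def divide_inverse by (auto intro: subring_mult)

lemma field_generated_least: "is_subfield L \<Longrightarrow> A \<subseteq> L \<Longrightarrow> field_generated A \<subseteq> L"
  unfolding field_generated_def by blast

lemma field_generated_incl: "A \<subseteq> field_generated A"
  unfolding field_generated_def by blast

lemma is_subfield_field_generated: "is_subfield (field_generated A)"
  unfolding field_generated_def is_subfield_def is_subring_def by auto

section \<open>Units, maximal ideal and orders in a valuation ring\<close>

definition ring_units :: "'a::field set \<Rightarrow> 'a set" where
  "ring_units R = {u \<in> R. u \<noteq> 0 \<and> inverse u \<in> R}"

text \<open>A relation rather than a function: one can compute with it before \<open>t\<close> is
  known to generate the maximal ideal. Uniqueness (\<open>has_ord_unique\<close>) and agreement with
  \<open>place_val\<close> (\<open>place_val_eq\<close>) come afterwards.\<close>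

definition has_ord :: "'a::field set \<Rightarrow> 'a \<Rightarrow> 'a \<Rightarrow> int \<Rightarrow> bool" where
  "has_ord R t z n \<longleftrightarrow> (\<exists>u\<in>ring_units R. z = t powi n * u)"

locale val_ring =
  fixes K F R :: "'a::field set"
  assumes F: "is_subfield F" and vr: "is_valuation_ring K F R"
begin

lemma subring: "is_subring R" and K_sub: "K \<subseteq> R" and R_sub: "R \<subseteq> F" and R_neq: "R \<noteq> F"
  and val: "z \<in> F \<Longrightarrow> z \<in> R \<or> inverse z \<in> R"
  using vr unfolding is_valuation_ring_def by auto

lemmas zero = subring_zero[OF subring]
lemmas one = subring_one[OF subring]
lemmas add = subring_add[OF subring]
lemmas diff = subring_diff[OF subring]
lemmas uminus = subring_uminus[OF subring]
lemmas mult = subring_mult[OF subring]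
lemmas power = subring_power[OF subring]

definition P where "P = R - ring_units R"

lemma unit_one: "1 \<in> ring_units R"
  by (simp add: ring_units_def one)

lemma unit_mult: "u \<in> ring_units R \<Longrightarrow> v \<in> ring_units R \<Longrightarrow> u * v \<in> ring_units R"
  by (auto simp: ring_units_def mult)

lemma unit_inverse: "u \<in> ring_units R \<Longrightarrow> inverse u \<in> ring_units R"
  by (auto simp: ring_units_def)

lemma unit_power: "u \<in> ring_units R \<Longrightarrow> u ^ n \<in> ring_units R"
  by (induction n) (auto intro: unit_one unit_mult)

lemma unit_powi: "u \<in> ring_units R \<Longrightarrow> u powi n \<in> ring_units R"
  by (auto simp: power_int_def intro: unit_power unit_inverse)

lemma unit_nz: "u \<in> ring_units R \<Longrightarrow> u \<noteq> 0"
  by (auto simp: ring_units_def)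

lemma unit_R: "u \<in> ring_units R \<Longrightarrow> u \<in> R"
  by (auto simp: ring_units_def)

lemma P_R: "z \<in> P \<Longrightarrow> z \<in> R"
  by (auto simp: P_def)

lemma P_zero: "0 \<in> P"
  by (auto simp: P_def ring_units_def zero)

lemma P_unit: "z \<in> P \<Longrightarrow> z \<notin> ring_units R"
  by (auto simp: P_def)

lemma P_one: "1 \<notin> P"
  using P_unit unit_one by blast

lemma unit_or_P: "z \<in> R \<Longrightarrow> z \<in> ring_units R \<or> z \<in> P"
  by (auto simp: P_def)

lemma P_mult: "a \<in> R \<Longrightarrow> z \<in> P \<Longrightarrow> a * z \<in> P"
proof -
  assume a: "a \<in> R" "z \<in> P"
  have "z \<in> ring_units R" if u: "a * z \<in> ring_units R"
  proof -
    have "z \<noteq> 0" "a \<noteq> 0" using u by (auto simp: ring_units_def)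
    then have "inverse z = a * inverse (a * z)" by simp
    moreover have "inverse (a * z) \<in> R" using u by (simp add: ring_units_def del: inverse_mult_distrib)
    ultimately have "inverse z \<in> R" using a mult by metis
    with \<open>z \<noteq> 0\<close> show ?thesis using a by (simp add: ring_units_def P_def)
  qed
  then show ?thesis using a mult by (auto simp: P_def)
qed

lemma P_mult2: "z \<in> P \<Longrightarrow> a \<in> R \<Longrightarrow> z * a \<in> P"
  using P_mult by (simp add: mult.commute)

lemma P_iff: "z \<noteq> 0 \<Longrightarrow> z \<in> P \<longleftrightarrow> z \<in> R \<and> inverse z \<notin> R"
  by (auto simp: P_def ring_units_def)

lemma inverse_P: "z \<in> F \<Longrightarrow> z \<notin> R \<Longrightarrow> inverse z \<in> P"
  using val[of z] zero by (cases "z = 0") (auto simp: P_def ring_units_def)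

text \<open>Of two elements of a valuation ring one divides the other, so the difference is a ring
  multiple of one of them. This is what makes the non-units an ideal.\<close>

lemma P_diff:
  assumes "a \<in> P" "b \<in> P" shows "a - b \<in> P"
proof -
  have *: "a - b \<in> P" if "a \<in> P" "b \<in> P" "a \<noteq> 0" "a * inverse b \<in> R" "b \<noteq> 0" for a b
  proof -
    have "a - b = (a * inverse b - 1) * b" using that by (simp add: field_simps)
    then show ?thesis using that by (metis P_mult diff one)
  qed
  have neg: "- c \<in> P" if "c \<in> P" for c
    using P_mult[of "-1" c] that by (simp add: uminus one)
  show ?thesis
  proof (cases "a = 0 \<or> b = 0")
    case True then show ?thesis using assms neg by auto
  next
    case False
    have "a * inverse b \<in> F" using assms P_R R_sub F unfolding is_subfield_def by (meson subset_iff subring_mult)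
    then consider "a * inverse b \<in> R" | "b * inverse a \<in> R"
      using val[of "a * inverse b"] by (auto simp: mult.commute)
    then show ?thesis
    proof cases
      case 1 then show ?thesis using * assms False by blast
    next
      case 2 then show ?thesis using *[of b a] neg[of "b - a"] assms False by simp
    qed
  qed
qed

lemma P_uminus: "a \<in> P \<Longrightarrow> - a \<in> P"
  using P_diff[OF P_zero] by fastforce

lemma P_add: "a \<in> P \<Longrightarrow> b \<in> P \<Longrightarrow> a + b \<in> P"
  using P_diff[of a "- b"] P_uminus[of b] by simp

lemma P_sum: "(\<And>i. i \<in> I \<Longrightarrow> g i \<in> P) \<Longrightarrow> sum g I \<in> P"
  by (induction I rule: infinite_finite_induct) (auto intro: P_zero P_add)

lemma unit_add_P:
  assumes "u \<in> ring_units R" "a \<in> P" shows "u + a \<in> ring_units R"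
proof (rule ccontr)
  assume "u + a \<notin> ring_units R"
  then have "u + a \<in> P" using assms by (simp add: P_def unit_R P_R add)
  then have "u \<in> P" using P_diff[of "u + a" a] assms by simp
  then show False using assms P_unit by blast
qed

lemma P_power: "a ^ n \<in> P \<Longrightarrow> a \<in> R \<Longrightarrow> a \<in> P"
  using unit_or_P[of a] unit_power[of a n] P_unit by blast

text \<open>Outside \<open>R\<close> the inverse of \<open>z\<close> is a non-unit, and then 1 would
  lie in \<open>P\<close>. Pure equations suffice here because y is an m-th root of a polynomial in
  x.\<close>

lemma integrally_closed:
  assumes "z \<in> F" "z ^ n \<in> R" "n > 0" shows "z \<in> R"
proof (rule ccontr)
  assume z: "z \<notin> R"
  then have i: "inverse z \<in> P" using inverse_P assms by blast
  obtain k where n: "n = Suc k" using assms by (cases n) auto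
  have "inverse z ^ n * z ^ n = 1" using z zero by (metis left_inverse power_mult_distrib power_one)
  moreover have "inverse z ^ n \<in> P" unfolding n using i by (simp add: P_mult2 P_R power)
  ultimately show False using P_mult2 assms P_one by metis
qed

lemma unit_root:
  assumes "z \<in> F" "z ^ n \<in> ring_units R" "n > 0" shows "z \<in> ring_units R"
proof -
  have "inverse z \<in> F" using assms F by (simp add: is_subfield_def)
  moreover have "inverse z ^ n \<in> R" using assms(2) by (simp add: ring_units_def power_inverse)
  moreover have "z \<noteq> 0" using unit_nz[OF assms(2)] assms(3) by (auto simp: power_0_left)
  ultimately show ?thesis using integrally_closed assms unit_R unfolding ring_units_def by blast
qed

lemma P_ideal: "is_ideal R P"
  unfolding is_ideal_def using P_zero P_R P_diff P_mult by auto

lemma ideal_subset_P: "is_ideal R J \<Longrightarrow> J \<noteq> R \<Longrightarrow> J \<subseteq> P"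
proof
  fix z assume J: "is_ideal R J" "J \<noteq> R" and z: "z \<in> J"
  show "z \<in> P"
  proof (rule ccontr)
    assume "z \<notin> P"
    then have "z \<in> ring_units R" using z J unfolding P_def is_ideal_def by blast
    then have "inverse z \<in> R" "inverse z * z = 1" by (auto simp: ring_units_def)
    then have "1 \<in> J" using z J unfolding is_ideal_def by metis
    then have "R \<subseteq> J" using J unfolding is_ideal_def by (metis mult.right_neutral subsetI)
    then show False using J unfolding is_ideal_def by auto
  qed
qed

lemma P_neq: "P \<noteq> R"
  using one P_one by blast

lemma P_maximal: "is_maximal_ideal R P"
  unfolding is_maximal_ideal_def using P_ideal P_neq ideal_subset_P by blast

lemma P_place: "is_place K F P"
  unfolding is_place_def using vr P_maximal by blast

lemma place_ring_P: "place_ring F P = R"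
proof -
  have "z \<in> R \<longleftrightarrow> z \<in> F \<and> (z = 0 \<or> inverse z \<notin> P)" for z
  proof (cases "z = 0")
    case True then show ?thesis using zero R_sub by auto
  next
    case False
    then show ?thesis using P_iff[of "inverse z"] inverse_P[of z] R_sub by auto
  qed
  then show ?thesis unfolding place_ring_def by blast
qed

lemma place_units_P: "place_units F P = ring_units R"
  unfolding place_units_def place_ring_P ring_units_def by simp

end

lemma (in val_ring) has_ord_mult:
  "t \<noteq> 0 \<Longrightarrow> has_ord R t z n \<Longrightarrow> has_ord R t z' n' \<Longrightarrow> has_ord R t (z * z') (n + n')"
proof -
  assume t: "t \<noteq> 0" and "has_ord R t z n" "has_ord R t z' n'"
  then obtain u v where u: "u \<in> ring_units R" "z = t powi n * u" and v: "v \<in> ring_units R" "z' = t powi n' * v"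
    unfolding has_ord_def by blast
  have "z * z' = t powi (n + n') * (u * v)" using t u v by (simp add: power_int_add)
  then show ?thesis using unit_mult[OF u(1) v(1)] unfolding has_ord_def by blast
qed

lemma (in val_ring) has_ord_powi:
  "t \<noteq> 0 \<Longrightarrow> has_ord R t z n \<Longrightarrow> has_ord R t (z powi k) (k * n)"
proof -
  assume "has_ord R t z n"
  then obtain u where u: "u \<in> ring_units R" "z = t powi n * u" unfolding has_ord_def by blast
  have "z powi k = t powi (k * n) * (u powi k)"
    using u by (simp add: power_int_mult_distrib mult.commute[of k] flip: power_int_mult)
  then show ?thesis using unit_powi[OF u(1)] unfolding has_ord_def by blast
qed

lemma (in val_ring) has_ord_power:
  "t \<noteq> 0 \<Longrightarrow> has_ord R t z n \<Longrightarrow> has_ord R t (z ^ k) (int k * n)"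
  using has_ord_powi[of t z n "int k"] by simp

lemma (in val_ring) has_ord_inverse:
  "t \<noteq> 0 \<Longrightarrow> has_ord R t z n \<Longrightarrow> has_ord R t (inverse z) (- n)"
  using has_ord_powi[of t z n "-1"] by simp

lemma (in val_ring) has_ord_divide:
  "t \<noteq> 0 \<Longrightarrow> has_ord R t z n \<Longrightarrow> has_ord R t z' n' \<Longrightarrow> has_ord R t (z / z') (n - n')"
  using has_ord_mult[OF _ _ has_ord_inverse] by (simp add: divide_inverse)

lemma (in val_ring) has_ord_unit: "u \<in> ring_units R \<Longrightarrow> has_ord R t u 0"
  unfolding has_ord_def by auto

lemma (in val_ring) has_ord_self: "has_ord R t t 1"
  unfolding has_ord_def using unit_one by force

lemma (in val_ring) has_ord_nz: "t \<noteq> 0 \<Longrightarrow> has_ord R t z n \<Longrightarrow> z \<noteq> 0"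
  unfolding has_ord_def using unit_nz by (auto simp: power_int_eq_0_iff)

lemma (in val_ring) has_ord_pos:
  assumes t: "t \<in> P" and h: "has_ord R t z n" and n: "n > 0" shows "z \<in> P"
proof -
  obtain u where u: "u \<in> ring_units R" "z = t powi n * u" using h unfolding has_ord_def by auto
  obtain k where k: "n = int (Suc k)" using n by (metis zero_less_imp_eq_int not0_implies_Suc order_less_irrefl)
  have "t powi n = t * t ^ k" unfolding k power_int_of_nat by simp
  then show ?thesis using u t by (simp add: P_mult2 power P_R unit_R)
qed

lemma (in val_ring) has_ord_R_iff:
  assumes t: "t \<in> P" "t \<noteq> 0" and h: "has_ord R t z n" shows "z \<in> R \<longleftrightarrow> 0 \<le> n"
proof -
  have z: "z \<noteq> 0" using has_ord_nz t h by blast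
  consider "n > 0" | "n = 0" | "n < 0" by linarith
  then show ?thesis
  proof cases
    case 1 then show ?thesis using has_ord_pos[OF t(1) h] P_R by simp
  next
    case 2 then show ?thesis using h unit_R unfolding has_ord_def by auto
  next
    case 3
    then have "inverse z \<in> P" using has_ord_pos[OF t(1) has_ord_inverse[OF t(2) h]] by simp
    then show ?thesis using 3 P_iff[of "inverse z"] z by auto
  qed
qed

lemma (in val_ring) has_ord_P_iff:
  assumes t: "t \<in> P" "t \<noteq> 0" and h: "has_ord R t z n" shows "z \<in> P \<longleftrightarrow> 0 < n"
  using P_iff[of z] has_ord_nz[OF t(2) h] has_ord_R_iff[OF t h] has_ord_R_iff[OF t has_ord_inverse[OF t(2) h]]
  by auto

lemma (in val_ring) has_ord_unique:
  assumes t: "t \<in> P" "t \<noteq> 0" and h: "has_ord R t z n" "has_ord R t z n'" shows "n = n'"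
proof -
  have "has_ord R t 1 (n - n')" "has_ord R t 1 (n' - n)"
    using has_ord_divide[OF t(2) h] has_ord_divide[OF t(2) h(2,1)] has_ord_nz[OF t(2) h(1)] by auto
  then have "0 \<le> n - n'" "0 \<le> n' - n" using has_ord_R_iff[OF t, of 1] one by blast+
  then show ?thesis by simp
qed

text \<open>Factor out the term of least order: the other quotients have positive order, so what
  remains is 1 plus an element of \<open>P\<close>, a unit. Equality, not just an inequality, rests
  on \<open>inj_on n I\<close>.\<close>

lemma (in val_ring) has_ord_sum:
  assumes t: "t \<in> P" "t \<noteq> 0" and I: "finite I" "I \<noteq> {}" "inj_on n I"
    and h: "\<And>i. i \<in> I \<Longrightarrow> has_ord R t (z i) (n i)"
  shows "has_ord R t (\<Sum>i\<in>I. z i) (Min (n ` I))"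
proof -
  have "Min (n ` I) \<in> n ` I" using I by simp
  then obtain k where k: "k \<in> I" "n k = Min (n ` I)" by auto
  have "z i / z k \<in> P" if "i \<in> I - {k}" for i
  proof -
    have "n k \<le> n i" using that k I by simp
    moreover have "n i \<noteq> n k" using that k(1) inj_onD[OF I(3)] by blast
    ultimately have "n i - n k > 0" by simp
    then show ?thesis using has_ord_pos[OF t(1) has_ord_divide[OF t(2) h[of i] h[of k]]] k that by simp
  qed
  then have "1 + (\<Sum>i\<in>I-{k}. z i / z k) \<in> ring_units R"
    by (intro unit_add_P[OF unit_one] P_sum)
  moreover have "(\<Sum>i\<in>I. z i) = z k * (1 + (\<Sum>i\<in>I-{k}. z i / z k))"
    using I k has_ord_nz[OF t(2) h[OF k(1)]]
    by (simp add: sum.remove[of I k] distrib_left sum_distrib_left)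
  ultimately show ?thesis using has_ord_mult[OF t(2) h[OF k(1)] has_ord_unit] k by simp
qed

lemma (in val_ring) has_ord_prod:
  assumes "t \<noteq> 0" "\<And>i. i \<in> I \<Longrightarrow> has_ord R t (g i) (n i)"
  shows "has_ord R t (prod g I) (sum n I)"
  using assms(2)
  by (induction I rule: infinite_finite_induct) (auto intro: has_ord_unit unit_one has_ord_mult[OF assms(1)])

lemma (in val_ring) unit_prod:
  "(\<And>i. i \<in> I \<Longrightarrow> g i \<in> ring_units R) \<Longrightarrow> prod g I \<in> ring_units R"
  by (induction I rule: infinite_finite_induct) (auto intro: unit_one unit_mult)

text \<open>The definite description admits every generator t' of \<open>P\<close>. Writing t = t'
  w, the orders of t' and w are positive and non-negative with sum 1, so t' has order 1 and yields
  the same integer as \<open>t\<close>.\<close>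

lemma (in val_ring) place_val_eq:
  assumes t: "t \<in> P" "t \<noteq> 0" and disc: "\<And>z. z \<in> F \<Longrightarrow> z \<noteq> 0 \<Longrightarrow> \<exists>n. has_ord R t z n"
    and h: "has_ord R t z n"
  shows "place_val F P z = n"
proof -
  have gen: "\<exists>w\<in>R. z = t * w" if "z \<in> P" for z
  proof (cases "z = 0")
    case True then show ?thesis using zero by auto
  next
    case False
    moreover have "z \<in> F" using that P_R R_sub by blast
    ultimately obtain n where n: "has_ord R t z n" using disc by meson
    have "has_ord R t (z / t) (n - 1)" using has_ord_divide[OF t(2) n has_ord_self] .
    then have "z / t \<in> R" using has_ord_R_iff[OF t] has_ord_P_iff[OF t n] that by simp
    then show ?thesis using t by (metis nonzero_mult_div_cancel_left times_divide_eq_right)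
  qed
  have Pt: "P = (\<lambda>w. t * w) ` R"
    using gen P_mult2[OF t(1)] by auto
  show ?thesis unfolding place_val_def place_ring_P place_units_P
  proof (rule the_equality)
    show "\<exists>t u. P = (*) t ` R \<and> u \<in> ring_units R \<and> z = t powi n * u"
      using Pt h unfolding has_ord_def by blast
  next
    fix n' assume "\<exists>t u. P = (*) t ` R \<and> u \<in> ring_units R \<and> z = t powi n' * u"
    then obtain t' u where t': "P = (*) t' ` R" and u: "u \<in> ring_units R" "z = t' powi n' * u" by auto
    have "t' \<in> P" using t' one by force
    moreover obtain w where w: "w \<in> R" "t = t' * w" using t t' by auto
    ultimately have "t' \<noteq> 0" "t' \<in> F" "w \<in> F" "w \<noteq> 0" using t P_R R_sub by auto
    then obtain a b where a: "has_ord R t t' a" and b: "has_ord R t w b" using disc by meson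
    have "a > 0" "b \<ge> 0" "a + b = 1"
      using has_ord_P_iff[OF t a] has_ord_R_iff[OF t b] \<open>t' \<in> P\<close> w
        has_ord_unique[OF t has_ord_mult[OF t(2) a b]] has_ord_self[of t] by auto
    then have "a = 1" by linarith
    then have "has_ord R t t' 1" using a by simp
    then have "has_ord R t z n'"
      using has_ord_mult[OF t(2) has_ord_powi[OF t(2)] has_ord_unit[OF u(1)]] u by fastforce
    then show "n' = n" using has_ord_unique[OF t] h by blast
  qed
qed

text \<open>Every proper ideal of a valuation ring consists of non-units, so its maximal ideal can
  only be the set of non-units.\<close>

lemma place_val_ring:
  assumes "is_subfield F" "is_place K F P"
  obtains R where "val_ring K F R" "P = val_ring.P R" "place_ring F P = R"
proof -
  obtain R where R: "is_valuation_ring K F R" "is_maximal_ideal R P"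
    using assms(2) unfolding is_place_def by auto
  interpret val_ring K F R using assms R by unfold_locales
  have "P = val_ring.P R"
    using ideal_subset_P[of P] P_ideal P_neq R(2) unfolding is_maximal_ideal_def by blast
  then show ?thesis using that val_ring_axioms place_ring_P by blast
qed

section \<open>Existence of valuation rings\<close>

definition adjoin :: "'a::field set \<Rightarrow> 'a \<Rightarrow> 'a set" where
  "adjoin A u = {poly p u | p. \<forall>i. coeff p i \<in> A}"

lemma adjoinI: "(\<And>i. coeff p i \<in> A) \<Longrightarrow> poly p u \<in> adjoin A u"
  unfolding adjoin_def by blast

lemma adjoin_incl: "is_subring A \<Longrightarrow> A \<subseteq> adjoin A u"
proof
  fix a assume "is_subring A" "a \<in> A"
  then show "a \<in> adjoin A u"
    using adjoinI[of "[:a:]" A u] by (auto simp: coeff_pCons subring_zero split: nat.split)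
qed

lemma adjoin_self: "is_subring A \<Longrightarrow> u \<in> adjoin A u"
  using adjoinI[of "[:0, 1:]" A u]
  by (auto simp: coeff_pCons subring_zero subring_one split: nat.split)

lemma is_subring_adjoin:
  assumes A: "is_subring A" shows "is_subring (adjoin A u)"
  unfolding is_subring_def
proof (intro conjI ballI)
  show "1 \<in> adjoin A u" using adjoin_incl[OF A] subring_one[OF A] by blast
  fix a b assume "a \<in> adjoin A u" "b \<in> adjoin A u"
  then obtain p q where p: "a = poly p u" "\<forall>i. coeff p i \<in> A" and q: "b = poly q u" "\<forall>i. coeff q i \<in> A"
    unfolding adjoin_def by auto
  have "a - b = poly (p - q) u" "\<forall>i. coeff (p - q) i \<in> A"
    using p q A by (auto intro: subring_diff)
  then show "a - b \<in> adjoin A u" unfolding adjoin_def by blast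
  have "a * b = poly (p * q) u" "\<forall>i. coeff (p * q) i \<in> A"
    using p q A by (auto simp: coeff_mult intro!: subring_sum subring_mult)
  then show "a * b \<in> adjoin A u" unfolding adjoin_def by blast
qed

lemma adjoin_least:
  assumes "is_subring B" "A \<subseteq> B" "u \<in> B" shows "adjoin A u \<subseteq> B"
  using assms unfolding adjoin_def poly_altdef
  by (auto intro!: subring_sum subring_mult subring_power)

text \<open>
  Two relations of minimal degree showing \<open>z\<close> to lie in both \<open>M[u]\<close> and \<open>M[u\<^sup>-\<^sup>1]\<close>
  can be combined to a relation of smaller degree.
\<close>

lemma adjoin_degree_reduce:
  fixes M :: "'a::field set" and p p' :: "'a poly"
  assumes M: "is_subring M" and w: "inverse z \<in> M" and z: "z \<noteq> 0" and u: "u \<noteq> 0"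
    and p: "\<forall>i. coeff p i \<in> M" "poly p u = z"
    and p': "\<forall>i. coeff p' i \<in> M" "poly p' (inverse u) = z"
    and deg: "degree p' \<le> degree p" "0 < degree p'"
  shows "\<exists>s. (\<forall>i. coeff s i \<in> M) \<and> poly s u = z \<and> degree s < degree p"
proof -
  define n where "n = degree p"
  define n' where "n' = degree p'"
  define b where "b = coeff p' 0"
  define R where "R = (\<Sum>j\<in>{1..n'}. monom (coeff p' j) (n' - j))"
  define t where "t = p - monom (coeff p n) n"
  \<comment> \<open>With w = 1/z one has z = b + (1 - w b) z. Expand the second z by
    \<open>p\<close>; its leading term contributes (1 - w b) u^n = w (z - b) u^n up to the
    coefficient, and this equals w u^(n - n') R(u), of degree below n in u.\<close>
  define s where "s = [:b:] + smult (1 - inverse z * b) t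
                        + monom (inverse z * coeff p n) (n - n') * R"
  have nn: "n' \<le> n" "0 < n'" using deg by (auto simp: n_def n'_def)
  have cR: "coeff R i \<in> M" for i
    unfolding R_def coeff_sum by (rule subring_sum[OF M]) (auto simp: p' subring_zero[OF M])
  have ct: "coeff t i \<in> M" for i
    unfolding t_def using p subring_zero[OF M] by (auto simp: subring_diff[OF M])
  have bM: "b \<in> M" "1 - inverse z * b \<in> M" "inverse z * coeff p n \<in> M"
    using p' p w M by (auto simp: b_def intro: subring_diff subring_mult subring_one)
  have cm: "coeff (monom c k * R) i \<in> M" if "c \<in> M" for c k i
    using that cR subring_zero[OF M] by (auto simp: coeff_monom_mult intro: subring_mult[OF M])
  have cs: "coeff s i \<in> M" for i
    unfolding s_def using bM ct cm subring_zero[OF M]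
    by (auto simp: coeff_pCons intro!: subring_add[OF M] subring_mult[OF M] split: nat.split)
  have Ru: "poly R u = (z - b) * u ^ n'"
  proof -
    have "z = (\<Sum>j\<le>n'. coeff p' j * inverse u ^ j)" using p' by (simp add: poly_altdef n'_def)
    also have "\<dots> = b + (\<Sum>j\<in>{1..n'}. coeff p' j * inverse u ^ j)"
      by (simp add: b_def sum.atLeast1_atMost_eq sum.atMost_shift lessThan_Suc_atMost flip: sum.atMost_Suc_shift)
    finally have "(z - b) * u ^ n' = (\<Sum>j\<in>{1..n'}. coeff p' j * (inverse u ^ j * u ^ n'))"
      by (simp add: sum_distrib_right mult.assoc)
    also have "\<dots> = poly R u"
      unfolding R_def poly_sum poly_monom
      by (rule sum.cong) (auto simp: u power_diff field_simps)
    finally show ?thesis ..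
  qed
  have tu: "poly t u = z - coeff p n * u ^ n" unfolding t_def using p by (simp add: poly_monom)
  have "u ^ (n - n') * u ^ n' = u ^ n" using nn by (simp flip: power_add)
  then have "poly s u = b + (1 - inverse z * b) * (z - coeff p n * u ^ n)
      + inverse z * coeff p n * (z - b) * u ^ n"
    unfolding s_def by (simp add: tu Ru poly_monom mult_ac)
  also have "\<dots> = z" using z by (simp add: field_simps)
  finally have su: "poly s u = z" .
  have "degree t < n"
  proof (rule degree_lessI)
    show "t \<noteq> 0 \<or> n > 0" using nn by auto
    show "\<forall>k\<ge>n. coeff t k = 0"
      unfolding t_def n_def by (auto simp: coeff_eq_0)
  qed
  moreover have "degree R < n'"
    unfolding R_def by (rule degree_sum_less) (use nn in \<open>auto intro: le_less_trans[OF degree_monom_le]\<close>)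
  then have "degree (monom (inverse z * coeff p n) (n - n') * R) < n"
    using nn degree_mult_le[of "monom (inverse z * coeff p n) (n - n')" R]
      degree_monom_le[of "inverse z * coeff p n" "n - n'"] by linarith
  moreover have "degree [:b:] < n" using nn by simp
  ultimately have "degree s < n"
    unfolding s_def by (auto intro!: degree_add_less le_less_trans[OF degree_smult_le])
  then show ?thesis using cs su n_def by blast
qed

text \<open>A subring M maximal among those between \<open>A\<close> and \<open>F\<close> that
  contain 1/z but not z is a valuation ring: if neither u nor 1/u were in M, maximality would put z
  into both M[u] and M[1/u], and relations of least degree could be shortened. The hypothesis on
  \<open>z\<close> says that z is not integral over \<open>A\<close>, since a relation z = p(1/z)
  becomes monic after multiplication by a power of z.\<close>

lemma exists_valuation_ring:
  fixes z :: "'a::field"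
  assumes F: "is_subfield F" and A: "is_subring A" "K \<subset> A" "A \<subseteq> F"
    and z: "z \<in> F" "z \<noteq> 0" "z \<notin> adjoin A (inverse z)"
  obtains R where "is_valuation_ring K F R" "A \<subseteq> R" "z \<notin> R"
proof -
  define S where "S = {M. is_subring M \<and> A \<subseteq> M \<and> M \<subseteq> F \<and> inverse z \<in> M \<and> z \<notin> M}"
  have F': "is_subring F" "inverse z \<in> F" using F z by (auto simp: is_subfield_def)
  have "\<exists>M\<in>S. \<forall>X\<in>S. M \<subseteq> X \<longrightarrow> X = M"
  proof (rule subset_Zorn_nonempty)
    have "adjoin A (inverse z) \<in> S"
      unfolding S_def using z(3) adjoin_self[OF A(1)] is_subring_adjoin[OF A(1)] adjoin_incl[OF A(1)]
        adjoin_least[OF F'(1) A(3) F'(2)] by simp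
    then show "S \<noteq> {}" by auto
  next
    fix C assume C: "C \<noteq> {}" "subset.chain S C"
    have CS: "C \<subseteq> S" using C by (simp add: subset.chain_def)
    have two: "\<exists>M\<in>C. a \<in> M \<and> b \<in> M" if "a \<in> \<Union>C" "b \<in> \<Union>C" for a b
      using that C unfolding subset.chain_def by blast
    have "is_subring (\<Union>C)"
      unfolding is_subring_def
    proof (intro conjI ballI)
      show "1 \<in> \<Union>C" using C CS unfolding S_def is_subring_def by blast
      fix a b assume "a \<in> \<Union>C" "b \<in> \<Union>C"
      then obtain M where "M \<in> C" "a \<in> M" "b \<in> M" using two by blast
      moreover have "is_subring M" using \<open>M \<in> C\<close> CS by (auto simp: S_def)
      ultimately show "a - b \<in> \<Union>C" "a * b \<in> \<Union>C" by (auto intro: subring_diff subring_mult)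
    qed
    then show "\<Union>C \<in> S" using C(1) CS unfolding S_def by blast
  qed
  then obtain M where MS: "M \<in> S" and max: "\<And>X. X \<in> S \<Longrightarrow> M \<subseteq> X \<Longrightarrow> X = M" by blast
  have M: "is_subring M" "A \<subseteq> M" "M \<subseteq> F" "inverse z \<in> M" "z \<notin> M" using MS by (auto simp: S_def)
  have ad: "\<exists>p. (\<forall>i. coeff p i \<in> M) \<and> poly p u = z" if "u \<in> F" "u \<notin> M" for u
  proof -
    have "adjoin M u \<noteq> M" using adjoin_self[OF M(1)] that by auto
    moreover have "M \<subseteq> adjoin M u" using adjoin_incl[OF M(1)] .
    ultimately have "adjoin M u \<notin> S" using max by blast
    moreover have "adjoin M u \<subseteq> F" using adjoin_least[OF F'(1) M(3) that(1)] .
    ultimately have "z \<in> adjoin M u"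
      unfolding S_def using M is_subring_adjoin[OF M(1)] \<open>M \<subseteq> adjoin M u\<close> by blast
    then show ?thesis unfolding adjoin_def by auto
  qed
  have min: "\<exists>p. (\<forall>i. coeff p i \<in> M) \<and> poly p u = z \<and>
      (\<forall>s. (\<forall>i. coeff s i \<in> M) \<and> poly s u = z \<longrightarrow> degree p \<le> degree s)" if u: "u \<in> F" "u \<notin> M" for u
    using ex_has_least_nat[of "\<lambda>p. (\<forall>i. coeff p i \<in> M) \<and> poly p u = z" _ degree] ad[OF u]
    by blast
  have pos: "0 < degree p" if "\<forall>i. coeff p i \<in> M" "poly p u = z" for p :: "'a poly" and u
    using that M(5) by (cases "degree p = 0") (auto elim!: degree_eq_zeroE simp: coeff_pCons split: nat.splits)
  have "u \<in> M \<or> inverse u \<in> M" if u: "u \<in> F" for u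
  proof (rule ccontr)
    assume "\<not> ?thesis"
    then have n: "u \<notin> M" "inverse u \<notin> M" by auto
    have u0: "u \<noteq> 0" using n subring_zero[OF M(1)] by auto
    have iu: "inverse u \<in> F" using u F by (simp add: is_subfield_def)
    obtain p where p: "\<forall>i. coeff p i \<in> M" "poly p u = z"
      "\<And>s. (\<forall>i. coeff s i \<in> M) \<Longrightarrow> poly s u = z \<Longrightarrow> degree p \<le> degree s" using min[OF u n(1)] by blast
    obtain p' where p': "\<forall>i. coeff p' i \<in> M" "poly p' (inverse u) = z"
      "\<And>s. (\<forall>i. coeff s i \<in> M) \<Longrightarrow> poly s (inverse u) = z \<Longrightarrow> degree p' \<le> degree s"
      using min[OF iu n(2)] by blast
    show False
    proof (cases "degree p' \<le> degree p")
      case True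
      then show False
        using adjoin_degree_reduce[OF M(1,4) z(2) u0 p(1,2) p'(1,2) _ pos[OF p'(1,2)]] p(3) by force
    next
      case False
      then show False
        using adjoin_degree_reduce[OF M(1,4) z(2) _ p'(1,2) p(1) _ _ pos[OF p(1,2)]] u0 p(2) p'(3) by force
    qed
  qed
  then have "is_valuation_ring K F M"
    unfolding is_valuation_ring_def using M A z by blast
  then show ?thesis using that M by blast
qed

section \<open>Kummer extensions and their totally ramified places\<close>

lemma hom_props:
  assumes "is_ring_hom h"
  shows hom_zero: "h 0 = 0" and hom_one: "h 1 = 1" and hom_add: "h (a + b) = h a + h b"
    and hom_mult: "h (a * b) = h a * h b" and hom_uminus: "h (- a) = - h a"
    and hom_diff: "h (a - b) = h a - h b"
proof -
  show h: "h 1 = 1" "h (a + b) = h a + h b" "h (a * b) = h a * h b" for a b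
    using assms by (auto simp: is_ring_hom_def)
  show z: "h 0 = 0" using h(2)[of 0 0] by simp
  show u: "h (- a) = - h a" for a using h(2)[of a "- a"] z by (simp add: eq_neg_iff_add_eq_0 add.commute)
  show "h (a - b) = h a - h b" using h(2)[of a "- b"] u by simp
qed

lemma hom_power: "is_ring_hom h \<Longrightarrow> h (a ^ n) = h a ^ n"
  by (induction n) (auto simp: hom_one hom_mult)

lemma hom_sum: "is_ring_hom h \<Longrightarrow> h (sum g I) = (\<Sum>i\<in>I. h (g i))"
  by (induction I rule: infinite_finite_induct) (auto simp: hom_zero hom_add)

lemma hom_prod:
  fixes h :: "'b::comm_ring_1 \<Rightarrow> 'c::comm_ring_1"
  shows "is_ring_hom h \<Longrightarrow> h (prod g I) = (\<Prod>i\<in>I. h (g i))"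
  by (induction I rule: infinite_finite_induct) (auto simp: hom_one hom_mult)

lemma is_ring_hom_eval:
  fixes h :: "'k::comm_ring_1 \<Rightarrow> 'a::comm_ring_1"
  assumes h: "is_ring_hom h"
  shows "is_ring_hom (\<lambda>p. poly (map_poly h p) a)"
proof -
  note hs = hom_zero[OF h] hom_add[OF h] hom_mult[OF h] hom_one[OF h]
  have add: "map_poly h (p + q) = map_poly h p + map_poly h q" for p q
    by (rule poly_eqI) (simp add: coeff_map_poly hs)
  have sm: "map_poly h (smult c q) = smult (h c) (map_poly h q)" for c q
    by (rule poly_eqI) (simp add: coeff_map_poly hs)
  have pc: "map_poly h (pCons c q) = pCons (h c) (map_poly h q)" for c q
    by (rule map_poly_pCons) (rule hs)
  have mult: "map_poly h (p * q) = map_poly h p * map_poly h q" for p q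
    by (induction p) (auto simp: add sm pc hs)
  show ?thesis
    unfolding is_ring_hom_def by (auto simp: add mult hs)
qed

lemma exists_linear_decomp:
  fixes g :: "'a::idom poly"
  obtains h where "g = [:poly g a:] + [:- a, 1:] * h"
proof -
  have "[:- a, 1:] dvd g - [:poly g a:]" by (simp add: poly_eq_0_iff_dvd[symmetric])
  then show ?thesis using that by (metis dvdE add.commute diff_add_cancel)
qed

lemma order_factor:
  fixes g :: "'a::field poly"
  assumes "g \<noteq> 0"
  obtains h where "g = [:- a, 1:] ^ order a g * h" "poly h a \<noteq> 0"
  using order_decomp[OF assms, of a] by (auto simp: poly_eq_0_iff_dvd)

locale kummer0 =
  fixes emb :: "'k::{field,finite} \<Rightarrow> 'a::field" and x y :: 'a
    and \<alpha> :: "nat \<Rightarrow> 'k" and m r :: nat and f :: "'k poly"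
  defines "f \<equiv> \<Prod>i=1..r. [:- \<alpha> i, 1:]"
  assumes emb: "is_ring_hom emb" and x: "transcendental_over emb x"
    and m: "m > 0" and r: "r > 0" and mr: "coprime m r" and mq: "coprime m (card (UNIV :: 'k set))"
    and alpha: "inj_on \<alpha> {1..r}" and y: "y ^ m = poly (map_poly emb f) x"
begin

definition cx :: "'k poly \<Rightarrow> 'a" where "cx g = poly (map_poly emb g) x"
definition ev :: "'k poly poly \<Rightarrow> 'a" where "ev G = poly (map_poly cx G) y"

abbreviation K where "K \<equiv> range emb"
abbreviation F where "F \<equiv> field_generated (K \<union> {x, y})"

lemma cx_hom: "is_ring_hom cx"
  unfolding cx_def[abs_def] by (rule is_ring_hom_eval[OF emb])

lemma ev_hom: "is_ring_hom ev"
  unfolding ev_def[abs_def] by (rule is_ring_hom_eval[OF cx_hom])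

lemmas emb_simps = hom_zero[OF emb] hom_one[OF emb] hom_add[OF emb] hom_mult[OF emb]
  hom_uminus[OF emb] hom_diff[OF emb] hom_power[OF emb]

lemmas cx_simps = hom_zero[OF cx_hom] hom_one[OF cx_hom] hom_add[OF cx_hom] hom_mult[OF cx_hom]
  hom_uminus[OF cx_hom] hom_diff[OF cx_hom] hom_power[OF cx_hom] hom_prod[OF cx_hom]

lemmas ev_simps = hom_zero[OF ev_hom] hom_one[OF ev_hom] hom_add[OF ev_hom] hom_mult[OF ev_hom]
  hom_uminus[OF ev_hom] hom_diff[OF ev_hom] hom_power[OF ev_hom]

lemma emb_eq_0: "emb c = 0 \<longleftrightarrow> c = 0"
proof
  assume "emb c = 0"
  then show "c = 0" using emb_simps(4)[of c "inverse c"] emb_simps(2) by (cases "c = 0") auto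
qed (simp add: emb_simps)

lemma cx_const: "cx [:c:] = emb c" and cx_X: "cx [:0, 1:] = x"
  by (simp_all add: cx_def map_poly_pCons emb_simps)

lemma cx_linear: "cx [:- c, 1:] = x - emb c"
  by (simp add: cx_def map_poly_pCons emb_simps)

lemma cx_eq_0: "cx g = 0 \<longleftrightarrow> g = 0"
  using x unfolding transcendental_over_def cx_def by (metis map_poly_0 poly_0)

lemma cx_altdef: "cx g = (\<Sum>i\<le>degree g. emb (coeff g i) * x ^ i)"
proof -
  have "map_poly emb g = (\<Sum>i\<le>degree g. monom (emb (coeff g i)) i)"
    by (rule poly_eqI) (auto simp: coeff_map_poly coeff_sum emb_simps coeff_eq_0 not_le)
  then show ?thesis by (simp add: cx_def poly_sum poly_monom)
qed

lemma ev_const: "ev [:g:] = cx g"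
  by (simp add: ev_def map_poly_pCons cx_simps)

lemma ev_pCons: "ev (pCons g G) = cx g + y * ev G"
  by (simp add: ev_def map_poly_pCons cx_simps)

lemma ev_monom: "ev (monom g i) = cx g * y ^ i"
  by (simp add: ev_def map_poly_monom cx_simps poly_monom)

lemma ev_smult: "ev (smult g G) = cx g * ev G"
  using ev_simps(4)[of "[:g:]" G] by (simp add: ev_const)

lemma ev_altdef:
  assumes "finite I" "{i. coeff G i \<noteq> 0} \<subseteq> I"
  shows "ev G = (\<Sum>i\<in>I. cx (coeff G i) * y ^ i)"
proof -
  have "map_poly cx G = (\<Sum>i\<in>I. monom (cx (coeff G i)) i)"
  proof (rule poly_eqI)
    fix n
    have "coeff G n = 0" if "n \<notin> I" using assms(2) that by blast
    then show "coeff (map_poly cx G) n = coeff (\<Sum>i\<in>I. monom (cx (coeff G i)) i) n"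
      using assms(1) by (auto simp: coeff_map_poly coeff_sum cx_simps if_distrib cong: if_cong)
  qed
  then show ?thesis by (simp add: ev_def poly_sum poly_monom)
qed

lemma y_eq: "y ^ m = cx f"
  using y by (simp add: cx_def)

lemma f_nz: "f \<noteq> 0"
  unfolding f_def by simp

lemma y_nz: "y \<noteq> 0"
proof
  assume "y = 0"
  then have "y ^ m = 0" using m by simp
  then show False using y_eq cx_eq_0[of f] f_nz by simp
qed

lemma degree_f: "degree f = r"
  unfolding f_def by (subst degree_prod_eq_sum_degree) auto

lemma finite_support: "finite {i. coeff G i \<noteq> 0}" and support_nonempty: "G \<noteq> 0 \<Longrightarrow> {i. coeff G i \<noteq> 0} \<noteq> {}"
proof -
  show "finite {i. coeff G i \<noteq> 0}"
    by (rule finite_subset[of _ "{..degree G}"]) (auto intro: le_degree)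
  show "G \<noteq> 0 \<Longrightarrow> {i. coeff G i \<noteq> 0} \<noteq> {}"
    using leading_coeff_0_iff by blast
qed

lemma reduce: "\<exists>G'. degree G' < m \<and> ev G' = ev G"
proof (induction G)
  case 0
  then show ?case using m by (intro exI[of _ 0]) simp
next
  case (pCons g G)
  then obtain G' where G': "degree G' < m" "ev G' = ev G" by auto
  \<comment> \<open>Multiplication by y raises the degree at most to m; the coefficient there is
    traded for a multiple of f in degree 0.\<close>
  define c where "c = coeff (pCons g G') m"
  define G'' where "G'' = pCons g G' - monom c m + [:c * f:]"
  have "ev G'' = ev (pCons g G)"
    unfolding G''_def using G' by (simp add: ev_simps ev_monom ev_const ev_pCons y_eq cx_simps)
  moreover have "degree G'' < m"
  proof -
    have "coeff G'' i = 0" if "i \<ge> m" for i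
    proof (cases "i = m")
      case True
      then show ?thesis using m by (auto simp: G''_def c_def coeff_pCons split: nat.split)
    next
      case False
      then have "i > m" using that by simp
      then have "coeff G' (i - 1) = 0" using G' by (intro coeff_eq_0) auto
      then show ?thesis using \<open>i > m\<close> by (auto simp: G''_def coeff_pCons split: nat.split)
    qed
    then show ?thesis using m by (intro degree_lessI) auto
  qed
  ultimately show ?case by blast
qed

lemma F_subfield: "is_subfield F"
  by (rule is_subfield_field_generated)

lemma F_subring: "is_subring F"
  using F_subfield by (simp add: is_subfield_def)

lemma cx_in: "is_subring R \<Longrightarrow> K \<subseteq> R \<Longrightarrow> x \<in> R \<Longrightarrow> cx g \<in> R"
  unfolding cx_altdef by (auto intro!: subring_sum subring_mult subring_power)

lemma ev_in: "is_subring R \<Longrightarrow> K \<subseteq> R \<Longrightarrow> x \<in> R \<Longrightarrow> y \<in> R \<Longrightarrow> ev G \<in> R"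
  by (subst ev_altdef[OF finite_support order_refl])
     (auto intro!: subring_sum subring_mult subring_power cx_in)

lemma F_gens: "K \<subseteq> F" "x \<in> F" "y \<in> F"
  using field_generated_incl[of "K \<union> {x, y}"] by auto

lemma cx_F: "cx g \<in> F"
  using cx_in F_gens F_subring by blast

text \<open>Quotients of elements of K[x, y] already form a subfield containing the generators.
  Denominators from K[x] alone become available only with \<open>norm_exists\<close>.\<close>

lemma F_fraction:
  assumes "z \<in> F" obtains G H where "ev H \<noteq> 0" "z = ev G / ev H"
proof -
  define L where "L = {ev G / ev H | G H. ev H \<noteq> 0}"
  have LI: "ev G / ev H \<in> L" if "ev H \<noteq> 0" for G H using that by (auto simp: L_def)
  have inc: "ev G \<in> L" for G using LI[of 1 G] by (simp add: ev_simps)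
  have "is_subfield L"
    unfolding is_subfield_def is_subring_def
  proof (intro conjI ballI)
    show "1 \<in> L" using inc[of 1] by (simp add: ev_simps)
    fix a b assume "a \<in> L" "b \<in> L"
    then obtain G H G' H' where a: "a = ev G / ev H" "ev H \<noteq> 0" and b: "b = ev G' / ev H'" "ev H' \<noteq> 0"
      unfolding L_def by auto
    have "a - b = ev (G * H' - G' * H) / ev (H * H')" using a b by (simp add: ev_simps diff_frac_eq)
    then show "a - b \<in> L" using LI[of "H * H'" "G * H' - G' * H"] a b by (simp add: ev_simps)
    have "a * b = ev (G * G') / ev (H * H')" using a b by (simp add: ev_simps)
    then show "a * b \<in> L" using LI[of "H * H'" "G * G'"] a b by (simp add: ev_simps)
  next
    fix a assume "a \<in> L"
    then obtain G H where a: "a = ev G / ev H" "ev H \<noteq> 0" unfolding L_def by auto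
    show "inverse a \<in> L"
      using LI[of G H] inc[of 0] a by (cases "ev G = 0") (auto simp: ev_simps)
  qed
  moreover have "K \<union> {x, y} \<subseteq> L"
  proof -
    have "emb c \<in> L" for c using inc[of "[:[:c:]:]"] by (simp add: ev_const cx_const)
    moreover have "x \<in> L" using inc[of "[:[:0,1:]:]"] by (simp add: ev_const cx_X)
    moreover have "y \<in> L" using inc[of "monom 1 1"] by (simp add: ev_monom cx_simps)
    ultimately show ?thesis by auto
  qed
  ultimately have "F \<subseteq> L" by (rule field_generated_least)
  then show ?thesis using assms that unfolding L_def by blast
qed

lemma alpha_injD: "i \<in> {1..r} \<Longrightarrow> k \<in> {1..r} \<Longrightarrow> \<alpha> i = \<alpha> k \<Longrightarrow> i = k"
  using alpha by (auto dest: inj_onD)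

text \<open>\<open>N g\<close> is the order of \<open>g(x)\<close> at the place of \<open>K(x)\<close> below, which has ramification index \<open>m\<close>.\<close>

definition totram :: "'a set \<Rightarrow> 'a \<Rightarrow> ('k poly \<Rightarrow> int) \<Rightarrow> int \<Rightarrow> bool" where
  "totram R t N e \<longleftrightarrow> val_ring K F R \<and> t \<in> val_ring.P R \<and> t \<noteq> 0 \<and> coprime (int m) e \<and>
     (\<forall>g. g \<noteq> 0 \<longrightarrow> has_ord R t (cx g) (int m * N g)) \<and> has_ord R t y e"

definition term_ord :: "('k poly \<Rightarrow> int) \<Rightarrow> int \<Rightarrow> 'k poly poly \<Rightarrow> nat \<Rightarrow> int" where
  "term_ord N e G i = int m * N (coeff G i) + int i * e"

definition ev_ord :: "('k poly \<Rightarrow> int) \<Rightarrow> int \<Rightarrow> 'k poly poly \<Rightarrow> int" where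
  "ev_ord N e G = Min (term_ord N e G ` {i. coeff G i \<noteq> 0})"

text \<open>Modulo m the order of the i-th term is i * e, and e is invertible modulo m.\<close>

lemma term_ord_inj:
  assumes "coprime (int m) e" "degree G < m"
  shows "inj_on (term_ord N e G) {i. coeff G i \<noteq> 0}"
proof (rule inj_onI)
  fix i j assume "i \<in> {i. coeff G i \<noteq> 0}" "j \<in> {i. coeff G i \<noteq> 0}" and eq: "term_ord N e G i = term_ord N e G j"
  then have ij: "i < m" "j < m" using assms le_degree by (auto intro: le_less_trans)
  have "(int i - int j) * e = int m * (N (coeff G j) - N (coeff G i))"
    using eq unfolding term_ord_def by (simp add: algebra_simps)
  then have "int m dvd (int i - int j) * e" by simp
  then have "int m dvd int i - int j" using assms(1) by (simp add: coprime_dvd_mult_left_iff)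
  then have "int i mod int m = int j mod int m" by (simp add: mod_eq_dvd_iff)
  then show "i = j" using ij by simp
qed

lemma totram_term:
  assumes "totram R t N e" "coeff G i \<noteq> 0"
  shows "has_ord R t (cx (coeff G i) * y ^ i) (term_ord N e G i)"
proof -
  interpret val_ring K F R using assms by (simp add: totram_def)
  show ?thesis using assms has_ord_mult has_ord_power unfolding totram_def term_ord_def by blast
qed

lemma totram_ev:
  assumes T: "totram R t N e" and G: "G \<noteq> 0" "degree G < m"
  shows "has_ord R t (ev G) (ev_ord N e G)"
proof -
  interpret val_ring K F R using T by (simp add: totram_def)
  show ?thesis
    unfolding ev_ord_def ev_altdef[OF finite_support order_refl, of G]
    using T G totram_term[OF T] support_nonempty term_ord_inj
    by (intro has_ord_sum finite_support) (auto simp: totram_def)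
qed

text \<open>An element that has an order is non-zero. This is the source of the independence of 1,
  y, ..., y^(m-1) over K(x); a single totally ramified place is enough.\<close>

lemma totram_indep:
  assumes T: "totram R t N e" and G: "G \<noteq> 0" "degree G < m"
  shows "ev G \<noteq> 0"
proof -
  interpret val_ring K F R using T by (simp add: totram_def)
  show ?thesis using totram_ev[OF assms] has_ord_nz T by (auto simp: totram_def)
qed

text \<open>That one \<open>n\<close> serves all \<open>R'\<close> with the same data makes the totally ramified places unique.\<close>

lemma totram_ord:
  assumes T: "totram R t N e" and z: "z \<in> F" "z \<noteq> 0"
  shows "\<exists>n. \<forall>R'. totram R' t N e \<longrightarrow> has_ord R' t z n"
proof -
  obtain G H where GH: "ev H \<noteq> 0" "z = ev G / ev H" using F_fraction z by blast
  obtain G' H' where G': "degree G' < m" "ev G' = ev G" and H': "degree H' < m" "ev H' = ev H"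
    using reduce by meson
  have nz: "G' \<noteq> 0" "H' \<noteq> 0" using GH G' H' z by (auto simp: ev_simps)
  have "has_ord R' t z (ev_ord N e G' - ev_ord N e H')" if T': "totram R' t N e" for R'
  proof -
    interpret val_ring K F R' using T' by (simp add: totram_def)
    show ?thesis using totram_ev[OF T' nz(1) G'(1)] totram_ev[OF T' nz(2) H'(1)] T' GH G' H'
      by (auto simp: totram_def intro: has_ord_divide)
  qed
  then show ?thesis by blast
qed

lemma totram_unique:
  assumes T: "totram R t N e" "totram R' t N e"
  shows "R = R'"
proof -
  interpret A: val_ring K F R using T by (simp add: totram_def)
  interpret B: val_ring K F R' using T by (simp add: totram_def)
  have "z \<in> R \<longleftrightarrow> z \<in> R'" if z: "z \<in> F" "z \<noteq> 0" for z
  proof -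
    obtain n where "has_ord R t z n" "has_ord R' t z n" using totram_ord[OF T(1) z] T by blast
    then show ?thesis using A.has_ord_R_iff B.has_ord_R_iff T unfolding totram_def by metis
  qed
  then show ?thesis using A.zero B.zero A.R_sub B.R_sub by blast
qed

section \<open>The places over the zeros of f and over the pole of x\<close>

lemma unit_emb:
  assumes "val_ring K F R" "c \<noteq> 0" shows "emb c \<in> ring_units R"
proof -
  interpret val_ring K F R by fact
  have "emb c * emb (inverse c) = 1" using assms(2) by (simp flip: emb_simps)
  then have "inverse (emb c) = emb (inverse c)" by (rule inverse_unique)
  then show ?thesis using assms K_sub by (auto simp: ring_units_def emb_eq_0)
qed

text \<open>As \<alpha> k is a simple zero of f, y^m is x - emb(\<alpha> k) times a unit. So y
  itself serves as uniformizer, and x - emb(\<alpha> k) has order m.\<close>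

lemma totram_finite:
  assumes V: "val_ring K F R" and k: "k \<in> {1..r}" and xk: "x - emb (\<alpha> k) \<in> val_ring.P R"
  shows "totram R y (\<lambda>g. int (order (\<alpha> k) g)) 1"
proof -
  interpret val_ring K F R by (rule V)
  let ?l = "x - emb (\<alpha> k)"
  have xR: "x \<in> R" using P_R[OF xk] K_sub add[of ?l "emb (\<alpha> k)"] by auto
  have cxR: "cx g \<in> R" for g using cx_in[OF subring K_sub xR] .
  have unit: "cx h \<in> ring_units R" if h: "poly h (\<alpha> k) \<noteq> 0" for h
  proof -
    obtain h' where h': "h = [:poly h (\<alpha> k):] + [:- \<alpha> k, 1:] * h'" by (rule exists_linear_decomp)
    have "cx h = emb (poly h (\<alpha> k)) + ?l * cx h'"
      by (subst h') (simp add: cx_simps(3,4) cx_const cx_linear del: mult_pCons_left)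
    then show ?thesis using unit_add_P[OF unit_emb[OF V h]] P_mult2[OF xk cxR] by simp
  qed
  have "f = [:- \<alpha> k, 1:] * (\<Prod>i\<in>{1..r}-{k}. [:- \<alpha> i, 1:])"
    unfolding f_def using k by (simp add: prod.remove del: mult_pCons_left)
  then have cf: "y ^ m = ?l * cx (\<Prod>i\<in>{1..r}-{k}. [:- \<alpha> i, 1:])"
    unfolding y_eq by (metis cx_simps(4) cx_linear)
  have "poly (\<Prod>i\<in>{1..r}-{k}. [:- \<alpha> i, 1:]) (\<alpha> k) \<noteq> 0"
    using k alpha_injD by (auto simp: poly_prod prod_zero_iff)
  then obtain u where u: "u \<in> ring_units R" "y ^ m = ?l * u" using unit cf by blast
  have yR: "y \<in> R" using integrally_closed[OF F_gens(3) _ m] cxR y_eq by metis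
  have yP: "y \<in> P" using P_power[OF _ yR, of m] u(2) P_mult2[OF xk unit_R[OF u(1)]] by simp
  have "?l = y powi (int m) * inverse u" using u unit_nz by simp
  then have l: "has_ord R y ?l (int m)" unfolding has_ord_def using unit_inverse[OF u(1)] by blast
  have "has_ord R y (cx g) (int m * int (order (\<alpha> k) g))" if g: "g \<noteq> 0" for g
  proof -
    obtain h where h: "g = [:- \<alpha> k, 1:] ^ order (\<alpha> k) g * h" "poly h (\<alpha> k) \<noteq> 0"
      using order_factor[OF g] .
    have "cx g = ?l ^ order (\<alpha> k) g * cx h"
      by (subst h(1)) (simp add: cx_simps(4,7) cx_linear)
    then show ?thesis
      using has_ord_mult[OF y_nz has_ord_power[OF y_nz l, of "order (\<alpha> k) g"] has_ord_unit[OF unit[OF h(2)]]]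
      by (simp add: mult.commute[of "int m"])
  qed
  then show ?thesis unfolding totram_def using V yP y_nz has_ord_self by auto
qed

text \<open>The orders of x and y ought to be -m and -r, so Bezout exponents u m + v r = 1 make
  x^(-u) y^(-v) an element of order 1. It is chosen before \<open>R\<close>:
  \<open>totram_unique\<close> compares two rings with the same uniformizer.\<close>

lemma totram_infinity:
  obtains t where "\<And>R. val_ring K F R \<Longrightarrow> x \<notin> R \<Longrightarrow> totram R t (\<lambda>g. - int (degree g)) (- int r)"
proof -
  obtain u v where uv: "u * int m + v * int r = 1"
  proof -
    have "gcd (int m) (int r) = 1" using mr by simp
    then show ?thesis using that bezout_int[of "int m" "int r"] by metis
  qed
  define t where "t = x powi (- u) * y powi (- v)"
  have x0: "x \<noteq> 0" using cx_X cx_eq_0[of "[:0,1:]"] by simp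
  have "totram R t (\<lambda>g. - int (degree g)) (- int r)" if V: "val_ring K F R" and xR: "x \<notin> R" for R
  proof -
    interpret val_ring K F R by (rule V)
    have ix: "inverse x \<in> P" using inverse_P F_gens xR by blast
    have lead: "\<exists>w\<in>ring_units R. cx g = x ^ degree g * w" if g: "g \<noteq> 0" for g
    proof -
      define n where "n = degree g"
      have "emb (coeff g i) * inverse x ^ (n - i) \<in> P" if "i < n" for i
      proof -
        have "inverse x ^ (n - i) = inverse x * inverse x ^ (n - i - 1)" using that
          by (metis Suc_diff_1 power_Suc zero_less_diff)
        then have "inverse x ^ (n - i) \<in> P" using ix by (simp add: P_mult2 P_R power)
        then show ?thesis using P_mult K_sub by blast
      qed
      then have "(\<Sum>i<n. emb (coeff g i) * inverse x ^ (n - i)) \<in> P" by (intro P_sum) auto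
      then have w: "emb (coeff g n) + (\<Sum>i<n. emb (coeff g i) * inverse x ^ (n - i)) \<in> ring_units R" (is "?w \<in> _")
        using unit_add_P[OF unit_emb[OF V]] g by (simp add: n_def)
      have "x ^ n * inverse x ^ (n - i) = x ^ i" if "i < n" for i
        using that x0 by (simp add: power_diff field_simps)
      then have "x ^ n * ?w = cx g"
        unfolding cx_altdef n_def[symmetric] lessThan_Suc_atMost[symmetric]
        by (simp add: distrib_left sum_distrib_left mult.left_commute[of "x ^ n"] add.commute mult.commute[of "x ^ n" "emb _"])
      then show ?thesis using w n_def by metis
    qed
    obtain w where w: "w \<in> ring_units R" "y ^ m = x ^ r * w"
      using lead[OF f_nz] by (auto simp: y_eq degree_f)
    have "t ^ m = x powi (- (u * int m)) * (y ^ m) powi (- v)"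
      unfolding t_def power_mult_distrib by (simp add: power_int_power power_int_power' mult.commute)
    also have "\<dots> = x powi (- (u * int m)) * (x powi (- (v * int r)) * w powi (- v))"
      unfolding w(2) power_int_mult_distrib by (simp add: power_int_power mult.commute)
    also have "\<dots> = x powi (- (u * int m) - v * int r) * w powi (- v)"
      using x0 by (simp add: power_int_diff power_int_minus field_simps)
    also have "- (u * int m) - v * int r = - 1" using uv by simp
    finally have tm: "t ^ m = inverse x * w powi (- v)" by simp
    have t0: "t \<noteq> 0" using x0 y_nz by (simp add: t_def power_int_eq_0_iff)
    have tF: "t \<in> F" unfolding t_def
      using F_subfield F_gens by (intro subring_mult[OF F_subring] subfield_powi)
    have "t ^ m \<in> P" using tm P_mult2[OF ix unit_R[OF unit_powi[OF w(1)]]] by simp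
    then have tP: "t \<in> P" using P_power integrally_closed[OF tF _ m] P_R by blast
    have "x = t powi (- int m) * w powi (- v)"
      using tm x0 t0 unit_nz[OF w(1)] by (simp add: power_int_minus field_simps)
    then have ox: "has_ord R t x (- int m)" unfolding has_ord_def using unit_powi[OF w(1)] by blast
    have "has_ord R t (cx g) (int m * (- int (degree g)))" if g: "g \<noteq> 0" for g
    proof -
      obtain w where "w \<in> ring_units R" "cx g = x ^ degree g * w" using lead[OF g] by blast
      then show ?thesis
        using has_ord_mult[OF t0 has_ord_power[OF t0 ox, of "degree g"] has_ord_unit]
        by (simp add: mult.commute[of "int m"])
    qed
    moreover have "has_ord R t y (- int r)"
    proof -
      \<comment> \<open>So far only y^m is known to have an order. The order of y follows because a
        root of a unit is a unit.\<close>
      have "has_ord R t ((y * t ^ r) ^ m) 0"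
      proof -
        have "has_ord R t (y ^ m) (- int m * int r)"
          using has_ord_mult[OF t0 has_ord_power[OF t0 ox, of r] has_ord_unit[OF w(1)]] w(2) by (simp add: mult.commute)
        then have "has_ord R t (y ^ m * t ^ (r * m)) (- int m * int r + int (r * m) * 1)"
          by (intro has_ord_mult has_ord_power t0 has_ord_self)
        then show ?thesis by (simp add: power_mult_distrib flip: power_mult)
      qed
      then have "(y * t ^ r) ^ m \<in> ring_units R" unfolding has_ord_def by auto
      then have "y * t ^ r \<in> ring_units R"
        using unit_root[OF _ _ m] F_gens tF subring_mult[OF F_subring] subring_power[OF F_subring] by blast
      moreover have "y = t powi (- int r) * (y * t ^ r)" using t0 by (simp add: power_int_minus)
      ultimately show ?thesis unfolding has_ord_def by blast
    qed
    ultimately show ?thesis unfolding totram_def using V tP t0 mr by simp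
  qed
  then show ?thesis using that by blast
qed

end

section \<open>Discreteness of all places\<close>

lemma exists_prime_elem_dvd:
  fixes c :: "'a::field poly"
  assumes "degree c > 0" obtains p where "prime_elem p" "p dvd c" "degree p > 0"
proof -
  obtain p where p: "p dvd c" "degree p > 0" and min: "\<And>q. q dvd c \<Longrightarrow> degree q > 0 \<Longrightarrow> degree p \<le> degree q"
    using ex_has_least_nat[of "\<lambda>p. p dvd c \<and> degree p > 0" c degree] assms by auto
  have p0: "p \<noteq> 0" using p by auto
  have "irreducible p"
  proof (rule irreducibleI)
    fix a b assume ab: "p = a * b"
    then have nz: "a \<noteq> 0" "b \<noteq> 0" using p0 by auto
    have "degree p = degree a + degree b" using nz by (simp add: ab degree_mult_eq)
    moreover have "degree p \<le> degree a" if "degree a > 0" using min[OF _ that] ab p by (meson dvd_mult_left)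
    moreover have "degree p \<le> degree b" if "degree b > 0" using min[OF _ that] ab p by (meson dvd_mult_right)
    ultimately have "degree a = 0 \<or> degree b = 0" by linarith
    then show "is_unit a \<or> is_unit b" using nz by (auto simp: is_unit_iff_degree)
  qed (use p p0 in \<open>auto simp: is_unit_iff_degree\<close>)
  then show ?thesis using that p field_poly_irreducible_imp_prime by blast
qed

lemma prime_elem_dvd_prodE:
  assumes "prime_elem p" "finite A" "p dvd prod g A" shows "\<exists>a\<in>A. p dvd g a"
  using assms(2,3)
proof (induction A rule: finite_induct)
  case empty
  then show ?case using assms(1) by (simp add: prime_elem_def)
next
  case (insert a A)
  then show ?case using prime_elem_dvd_multD[OF assms(1), of "g a" "prod g A"] by auto
qed

lemma power_decomp:
  fixes p c :: "'a::field poly"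
  assumes "c \<noteq> 0" "degree p > 0" shows "\<exists>k c'. c = p ^ k * c' \<and> \<not> p dvd c'"
  using assms(1)
proof (induction "degree c" arbitrary: c rule: less_induct)
  case less
  show ?case
  proof (cases "p dvd c")
    case True
    then obtain d where d: "c = p * d" by (auto elim: dvdE)
    then have "d \<noteq> 0" "degree d < degree c" using less.prems assms(2) by (auto simp: degree_mult_eq)
    then obtain k c' where "d = p ^ k * c'" "\<not> p dvd c'" using less.hyps by blast
    then show ?thesis using d by (intro exI[of _ "Suc k"]) auto
  next
    case False
    then show ?thesis by (intro exI[of _ 0] exI[of _ c]) simp
  qed
qed

text \<open>Applied twice, first to constants and then to the resulting finite set of remainders as
  coefficients, this yields finiteness of K[x, y] modulo a prime of K[x].\<close>

lemma finite_bounded_polys: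
  assumes "finite U" shows "finite {p. degree p < n \<and> (\<forall>i. coeff p i \<in> U)}"
proof (rule finite_subset)
  show "finite (Poly ` {xs. set xs \<subseteq> U \<and> length xs \<le> n})"
    using finite_lists_length_le[OF assms] by simp
  show "{p. degree p < n \<and> (\<forall>i. coeff p i \<in> U)} \<subseteq> Poly ` {xs. set xs \<subseteq> U \<and> length xs \<le> n}"
  proof
    fix p assume p: "p \<in> {p. degree p < n \<and> (\<forall>i. coeff p i \<in> U)}"
    have "set (coeffs p) \<subseteq> U" using p by (auto simp: coeffs_def split: if_splits)
    moreover have "length (coeffs p) \<le> n" using p by (auto simp: coeffs_def)
    ultimately show "p \<in> Poly ` {xs. set xs \<subseteq> U \<and> length xs \<le> n}"
      by (intro image_eqI[of _ _ "coeffs p"]) auto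
  qed
qed

lemma exists_smult_eq:
  fixes G :: "'a::idom poly"
  assumes "\<And>i. p dvd coeff G i" obtains V where "G = smult p V"
proof -
  obtain h where h: "\<And>i. coeff G i = p * h i" using assms unfolding dvd_def by metis
  have "G = smult p (\<Sum>i\<le>degree G. monom (h i) i)"
  proof (rule poly_eqI)
    fix n show "coeff G n = coeff (smult p (\<Sum>i\<le>degree G. monom (h i) i)) n"
    proof (cases "n \<le> degree G")
      case True
      then show ?thesis by (simp add: coeff_sum h)
    next
      case False
      then show ?thesis using coeff_eq_0[of G n] by (simp add: coeff_sum)
    qed
  qed
  then show ?thesis using that by blast
qed

text \<open>The extra assumption says that F has degree m over K(x). It is kept apart because it is
  obtained from a totally ramified place in general, but trivially when m = 1.\<close>

locale kummer = kummer0 emb x y \<alpha> m r f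
  for emb :: "'k::{field,finite} \<Rightarrow> 'a::field" and x y :: 'a
    and \<alpha> :: "nat \<Rightarrow> 'k" and m r :: nat and f :: "'k poly" +
  assumes indep: "\<And>G. G \<noteq> 0 \<Longrightarrow> degree G < m \<Longrightarrow> ev G \<noteq> 0"
begin

lemma ev_inj:
  assumes "degree G < m" "degree H < m" "ev G = ev H" shows "G = H"
  using indep[of "G - H"] assms degree_diff_less[of G m H] by (auto simp: ev_simps)

text \<open>
  A non-zero multiple \<open>h(y)\<close> of \<open>ev G\<close> of least degree in \<open>y\<close> divides \<open>y\<^sup>m - f\<close> up to a factor from
  \<open>K[x]\<close>; as the cofactor cannot vanish at \<open>y\<close> unless it has degree \<open>m\<close>, \<open>h\<close> is constant.
\<close>

lemma norm_exists:
  assumes "ev G \<noteq> 0" shows "\<exists>H c. c \<noteq> 0 \<and> ev G * ev H = cx c"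
proof -
  define A where "A h \<longleftrightarrow> h \<noteq> 0 \<and> degree h < m \<and> (\<exists>H. ev h = ev G * ev H)" for h
  obtain G' where G': "degree G' < m" "ev G' = ev G" using reduce by blast
  have "A G'" using G' assms unfolding A_def by (auto simp: ev_simps intro!: exI[of _ 1])
  then obtain h where h: "A h" and min: "\<And>g. A g \<Longrightarrow> degree h \<le> degree g"
    using ex_has_least_nat[of A _ degree] by blast
  then obtain H where H: "ev h = ev G * ev H" and h0: "h \<noteq> 0" "degree h < m" unfolding A_def by blast
  define M where "M = monom 1 m - [:f:]"
  have evM: "ev M = 0" by (simp add: M_def ev_simps ev_monom ev_const y_eq cx_simps)
  have dM: "degree M = m"
  proof (rule antisym)
    show "degree M \<le> m" unfolding M_def by (rule degree_diff_le) (auto simp: degree_monom_le)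
    show "m \<le> degree M" using m by (intro le_degree) (auto simp: M_def coeff_pCons split: nat.split)
  qed
  \<comment> \<open>The coefficients lie in K[x], not in a field, so division by \<open>h\<close>
    needs a factor \<open>a\<close>. The remainder is again a multiple of ev G, hence zero by
    minimality of \<open>h\<close>.\<close>
  obtain a k where a: "a \<noteq> 0" and ak: "smult a M = h * k + pseudo_mod M h"
    and d: "pseudo_mod M h = 0 \<or> degree (pseudo_mod M h) < degree h"
    using pseudo_mod[OF h0(1), of M] by blast
  have "ev (pseudo_mod M h) = ev (smult a M) - ev h * ev k" by (simp add: ak ev_simps)
  also have "\<dots> = ev G * ev (- (H * k))" by (simp add: evM ev_smult ev_simps H)
  finally have e: "ev (pseudo_mod M h) = ev G * ev (- (H * k))" .
  have pm: "pseudo_mod M h = 0"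
  proof (rule ccontr)
    assume n: "pseudo_mod M h \<noteq> 0"
    then have "A (pseudo_mod M h)" using d h0 e unfolding A_def by auto
    then show False using min d n by fastforce
  qed
  have hk: "smult a M = h * k" using ak pm by simp
  have "M \<noteq> 0" using dM m by auto
  then have k0: "k \<noteq> 0" using hk a by auto
  have dk: "degree h + degree k = m"
    using a dM degree_mult_eq[OF h0(1) k0] degree_smult_eq[of a M] hk by simp
  have "ev h * ev k = ev (smult a M)" using hk by (simp add: ev_simps)
  then have "ev h * ev k = 0" by (simp add: ev_smult evM)
  then have "ev k = 0" using indep[OF h0] by simp
  then have "degree h = 0" using indep[OF k0] dk by fastforce
  then obtain c where "h = [:c:]" by (rule degree_eq_zeroE)
  then show ?thesis using H h0 by (intro exI[of _ H] exI[of _ c]) (auto simp: ev_const)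
qed

text \<open>
  \<open>B / p B\<close> is reduced for \<open>B = K[x, y]\<close> if \<open>p\<close> does not divide \<open>f\<close>: a power of the Frobenius map
  with exponent \<open>Q \<equiv> 1 (mod m)\<close> sends \<open>g y\<^sup>i\<close> to a multiple of \<open>y\<^sup>i\<close> again.
\<close>

lemma reduced_mod_prime:
  assumes p: "prime_elem p" "\<not> p dvd f" and G: "degree G < m" and e: "ev G ^ n = cx p * ev H"
  shows "p dvd coeff G i"
proof -
  define c where "c = CHAR('k)"
  have c: "prime c"
    unfolding c_def by (intro prime_CHAR_semidom finite_imp_CHAR_pos) simp
  have c2: "c \<ge> 2" using c by (rule prime_ge_2_nat)
  have "c dvd card (UNIV :: 'k set)" unfolding c_def by (rule CHAR_dvd_CARD)
  then have "coprime c m" using mq by (meson coprime_commute coprime_divisors dvd_refl)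
  \<comment> \<open>The power of a sum is expanded in the ambient field, so its characteristic has
    to be identified with that of the constants.\<close>
  have "of_nat k = (0::'a) \<longleftrightarrow> of_nat k = (0::'k)" for k
  proof -
    have "emb (of_nat k) = of_nat k" by (induction k) (auto simp: emb_simps)
    then show ?thesis using emb_eq_0[of "of_nat k"] by simp
  qed
  then have cha: "CHAR('a) = c" unfolding c_def
    by (intro CHAR_eqI) (auto simp: of_nat_eq_0_iff_char_dvd)
  \<comment> \<open>Euler's theorem makes Q congruent to 1 modulo m, and the factor n in the
    exponent ensures Q >= n. With Q = 1 + m d the power (y^i)^Q is y^i f^(i d).\<close>
  define Q where "Q = c ^ (totient m * n)"
  have "[(c ^ totient m) ^ n = 1 ^ n] (mod m)" using euler_theorem[OF \<open>coprime c m\<close>] by (rule cong_pow)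
  then have "[Q = 1] (mod m)" by (simp add: Q_def power_mult)
  moreover have "Q \<ge> 1" using c2 by (simp add: Q_def)
  ultimately have "m dvd Q - 1" by (metis cong_altdef_nat)
  then obtain d where "Q - 1 = m * d" by (auto elim: dvdE)
  then have d: "Q = 1 + m * d" using \<open>Q \<ge> 1\<close> by linarith
  have "1 \<le> totient m" using m by (simp add: Suc_le_eq)
  then have "n \<le> totient m * n" by simp
  also have "\<dots> < 2 ^ (totient m * n)" by (rule less_exp)
  also have "\<dots> \<le> Q" unfolding Q_def using c2 by (rule power_mono) simp
  finally have nQ: "n \<le> Q" by simp
  define G' where "G' = (\<Sum>i<m. monom (coeff G i ^ Q * f ^ (i * d)) i)"
  have sup: "{i. coeff G i \<noteq> 0} \<subseteq> {..<m}" using G le_degree by (auto intro: le_less_trans)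
  have "ev G ^ Q = (\<Sum>i<m. cx (coeff G i) * y ^ i) ^ Q"
    by (subst ev_altdef[OF _ sup]) auto
  also have "\<dots> = (\<Sum>i<m. (cx (coeff G i) * y ^ i) ^ Q)"
    by (rule freshmans_dream_sum'[where n = "totient m * n"]) (simp_all add: cha c Q_def)
  also have "\<dots> = (\<Sum>i<m. cx (coeff G i ^ Q * f ^ (i * d)) * y ^ i)"
  proof (rule sum.cong)
    fix i
    have "(y ^ i) ^ Q = y ^ i * (y ^ m) ^ (i * d)"
      by (simp add: d algebra_simps flip: power_mult power_add)
    then show "(cx (coeff G i) * y ^ i) ^ Q = cx (coeff G i ^ Q * f ^ (i * d)) * y ^ i"
      by (simp add: cx_simps power_mult_distrib y_eq)
  qed simp
  also have "\<dots> = ev G'" unfolding G'_def by (simp add: hom_sum[OF ev_hom] ev_monom)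
  finally have 1: "ev G ^ Q = ev G'" .
  obtain H' where H': "degree H' < m" "ev H' = ev (H * G ^ (Q - n))" using reduce by blast
  have "ev G ^ Q = ev G ^ n * ev G ^ (Q - n)" using nQ by (simp flip: power_add)
  also have "\<dots> = cx p * ev H'" by (simp add: e H' ev_simps)
  finally have "ev G' = ev (smult p H')" using 1 by (simp add: ev_smult)
  moreover have "degree G' < m" unfolding G'_def
    by (rule degree_sum_less) (auto intro: le_less_trans[OF degree_monom_le] simp: m)
  ultimately have GH: "G' = smult p H'"
    using H' by (intro ev_inj) (auto intro: le_less_trans[OF degree_smult_le])
  show ?thesis
  proof (cases "i < m")
    case True
    then have "coeff G' i = coeff G i ^ Q * f ^ (i * d)" by (simp add: G'_def coeff_sum)
    moreover have "p dvd coeff G' i" unfolding GH by simp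
    ultimately have "p dvd coeff G i ^ Q * f ^ (i * d)" by simp
    then show ?thesis using p prime_elem_dvd_multD prime_elem_dvd_power by blast
  next
    case False
    then show ?thesis using G by (simp add: coeff_eq_0)
  qed
qed

text \<open>
  A generator \<open>p\<close> of \<open>P \<inter> K[x]\<close> is a uniformizer: for \<open>w \<in> B \<inter> P\<close> two powers of \<open>w\<close> agree modulo
  \<open>p B\<close> by finiteness of \<open>B / p B\<close>, so \<open>u = 1 - w\<^sup>k\<close> is a unit with \<open>w u\<close> nilpotent modulo \<open>p B\<close>.
\<close>

lemma unramified_discrete:
  assumes V: "val_ring K F R" and xR: "x \<in> R" and n: "\<And>k. k \<in> {1..r} \<Longrightarrow> x - emb (\<alpha> k) \<notin> val_ring.P R"
  shows "\<exists>t\<in>val_ring.P R. t \<noteq> 0 \<and> (\<forall>z\<in>F. z \<noteq> 0 \<longrightarrow> (\<exists>n. has_ord R t z n))"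
proof -
  interpret val_ring K F R by (rule V)
  have cxR: "cx g \<in> R" for g using cx_in[OF subring K_sub xR] .
  have yR: "y \<in> R" using integrally_closed[OF F_gens(3) _ m] cxR y_eq by metis
  have evR: "ev G \<in> R" for G using ev_in[OF subring K_sub xR yR] .
  \<comment> \<open>Otherwise all non-zero polynomials in x would be units of \<open>R\<close>;
    since every element of \<open>F\<close> has a denominator in K[x], \<open>R\<close> would be all
    of \<open>F\<close>.\<close>
  have "\<exists>g. g \<noteq> 0 \<and> cx g \<in> P"
  proof (rule ccontr)
    assume "\<not> ?thesis"
    then have u: "cx c \<in> ring_units R" if "c \<noteq> 0" for c using unit_or_P[OF cxR] that by blast
    have "z \<in> R" if z: "z \<in> F" for z
    proof -
      obtain G H where GH: "ev H \<noteq> 0" "z = ev G / ev H" using F_fraction[OF z] by blast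
      obtain H' c where c: "c \<noteq> 0" "ev H * ev H' = cx c" using norm_exists[OF GH(1)] by blast
      have "z = ev G * ev H' * inverse (cx c)" using GH c unit_nz[OF u[OF c(1)]]
        by (simp add: c(2)[symmetric] divide_inverse)
      then show ?thesis using u[OF c(1)] by (simp add: ring_units_def mult evR)
    qed
    then show False using R_neq R_sub by blast
  qed
  then obtain g where g: "g \<noteq> 0" "cx g \<in> P" and min: "\<And>h. h \<noteq> 0 \<Longrightarrow> cx h \<in> P \<Longrightarrow> degree g \<le> degree h"
    using ex_has_least_nat[of "\<lambda>g. g \<noteq> 0 \<and> cx g \<in> P" _ degree] by blast
  have "degree g > 0"
  proof (rule ccontr)
    assume "\<not> ?thesis"
    then obtain c where "g = [:c:]" by (auto elim: degree_eq_zeroE)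
    then show False using g unit_emb[OF V, of c] P_unit by (auto simp: cx_const)
  qed
  then obtain p where p: "prime_elem p" "p dvd g" "degree p > 0" by (rule exists_prime_elem_dvd)
  then obtain g1 where g1: "g = p * g1" by (auto elim: dvdE)
  have p0: "p \<noteq> 0" using p by auto
  have g1n: "g1 \<noteq> 0" "degree g1 < degree g" using g1 g p by (auto simp: degree_mult_eq)
  have cp0: "cx p \<noteq> 0" using p0 cx_eq_0 by simp
  have pP: "cx p \<in> P"
  proof (rule ccontr)
    assume "cx p \<notin> P"
    then have "cx p \<in> ring_units R" using unit_or_P[OF cxR] by blast
    then have "inverse (cx p) * cx g \<in> P" using P_mult[OF _ g(2)] by (simp add: ring_units_def)
    moreover have "inverse (cx p) * cx g = cx g1" using cp0 by (simp add: g1 cx_simps(4))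
    ultimately have "cx g1 \<in> P" by simp
    then show False using min[OF g1n(1)] g1n by simp
  qed
  have pdvd: "p dvd h" if "cx h \<in> P" for h
  proof (rule ccontr)
    assume nd: "\<not> p dvd h"
    have "h mod p = h - p * (h div p)" by (simp add: minus_mult_div_eq_mod)
    then have "cx (h mod p) \<in> P" using that pP by (simp add: cx_simps P_diff P_mult2 cxR)
    moreover have "h mod p \<noteq> 0" using nd by (simp add: dvd_eq_mod_eq_0)
    ultimately have "degree g \<le> degree (h mod p)" using min by blast
    moreover have "degree (h mod p) < degree p" using degree_mod_less[OF p0, of h] \<open>h mod p \<noteq> 0\<close> by blast
    moreover have "degree p \<le> degree g" using p(2) g(1) by (rule dvd_imp_degree_le)
    ultimately show False by simp
  qed
  \<comment> \<open>A prime factor of f divides some X - \<alpha> k, whose value would then lie in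
    \<open>P\<close>, contrary to the choice of \<open>R\<close>.\<close>
  have nf: "\<not> p dvd f"
  proof
    assume "p dvd f"
    then obtain k where k: "k \<in> {1..r}" "p dvd [:- \<alpha> k, 1:]"
      using prime_elem_dvd_prodE[OF p(1)] unfolding f_def by blast
    then obtain h where "[:- \<alpha> k, 1:] = p * h" by (auto elim: dvdE)
    then have "x - emb (\<alpha> k) = cx p * cx h" by (metis cx_linear cx_simps(4))
    then show False using n[OF k(1)] P_mult2[OF pP cxR] by simp
  qed
  have step: "\<exists>U V. ev U \<notin> P \<and> ev G * ev U = cx p * ev V" if GP: "ev G \<in> P" for G
  proof -
    obtain W where W: "\<And>j. degree (W j) < m" "\<And>j::nat. ev (W j) = ev G ^ j"
      using reduce[of "G ^ _"] unfolding ev_simps by metis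
    define T where "T = {A. degree A < m \<and> (\<forall>i. coeff A i \<in> {h. degree h < degree p \<and> (\<forall>i. coeff h i \<in> (UNIV::'k set))})}"
    have fT: "finite T" unfolding T_def by (intro finite_bounded_polys) simp
    have "map_poly (\<lambda>h. h mod p) (W j) \<in> T" for j
    proof -
      have "degree (h mod p) < degree p" for h using degree_mod_less[OF p0, of h] p(3) by auto
      moreover have "degree (map_poly (\<lambda>h. h mod p) (W j)) < m"
        using map_poly_degree_leq[of "\<lambda>h. h mod p" "W j"] W(1)[of j] by (rule le_less_trans)
      ultimately show ?thesis unfolding T_def by (simp add: coeff_map_poly)
    qed
    then have "\<not> inj (\<lambda>j. map_poly (\<lambda>h. h mod p) (W j))"
      using fT by (metis finite_subset image_subsetI range_inj_infinite)
    then obtain j l where jl: "j < l" and eq: "map_poly (\<lambda>h. h mod p) (W j) = map_poly (\<lambda>h. h mod p) (W l)"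
      unfolding inj_def by (metis linorder_neqE_nat)
    have "coeff (W j) i mod p = coeff (W l) i mod p" for i
      using arg_cong[OF eq, of "\<lambda>q. coeff q i"] by (simp add: coeff_map_poly)
    then have "p dvd coeff (W j - W l) i" for i by (simp add: mod_eq_dvd_iff)
    then obtain V where "W j - W l = smult p V" using exists_smult_eq by blast
    then have V: "ev G ^ j - ev G ^ l = cx p * ev V" by (metis W(2) ev_smult ev_simps(6))
    define U where "U = 1 - G ^ (l - j)"
    have "ev G ^ (l - j) \<in> P"
      using GP jl P_mult2[OF GP, of "ev G ^ (l - j - 1)"] power[OF evR]
      by (metis Suc_diff_1 power_Suc zero_less_diff)
    then have U: "ev U \<in> ring_units R"
      using unit_add_P[OF unit_one P_uminus] by (simp add: U_def ev_simps)
    have "ev G ^ j * ev U = cx p * ev V"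
      using V jl by (simp add: U_def ev_simps right_diff_distrib flip: power_add)
    \<comment> \<open>Multiplying by further factors turns the relation into one about a power of
      the single element G U, as \<open>reduced_mod_prime\<close> requires.\<close>
    then have pw: "(ev G * ev U) ^ (j + 1) = cx p * ev (V * G * U ^ j)"
      by (simp add: ev_simps power_mult_distrib mult_ac)
    obtain G2 where G2: "degree G2 < m" "ev G2 = ev (G * U)" using reduce by blast
    then have "p dvd coeff G2 i" for i
      using reduced_mod_prime[OF p(1) nf G2(1) pw[folded ev_simps(4), folded G2(2)]] by blast
    then obtain V2 where "G2 = smult p V2" using exists_smult_eq by blast
    then have "ev G * ev U = cx p * ev V2" using G2 by (simp add: ev_simps ev_smult)
    then show ?thesis using P_unit U by blast
  qed
  have main: "\<exists>n. has_ord R (cx p) (ev G) n" if G: "ev G \<noteq> 0" for G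
  proof -
    obtain H c where c: "c \<noteq> 0" "ev G * ev H = cx c" using norm_exists[OF G] by blast
    obtain k c' where k: "c = p ^ k * c'" "\<not> p dvd c'" using power_decomp[OF c(1) p(3)] by blast
    define D where "D \<longleftrightarrow> (\<exists>i U V. ev U \<notin> P \<and> ev V \<notin> P \<and> ev G * ev U = cx p ^ i * ev V)"
    \<comment> \<open>Either the division by p, up to units, stops with a unit (\<open>D\<close>),
      or it goes on. The norm c = p^k c' allows at most k divisions: one more would put c' times a
      unit into \<open>P\<close>, although p does not divide c'.\<close>
    have "D \<or> (\<exists>U V. ev U \<notin> P \<and> ev G * ev U = cx p ^ n * ev V)" for n
    proof (induction n)
      case 0
      show ?case using P_one by (intro disjI2 exI[of _ 1] exI[of _ G]) (simp add: ev_simps)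
    next
      case (Suc n)
      show ?case
      proof (cases D)
        case False
        then obtain U V where UV: "ev U \<notin> P" "ev G * ev U = cx p ^ n * ev V" using Suc by blast
        then have "ev V \<in> P" using False unfolding D_def by blast
        then obtain U' V' where U': "ev U' \<notin> P" "ev V * ev U' = cx p * ev V'" using step by blast
        have "ev (U * U') \<notin> P"
          using UV(1) U'(1) unit_or_P[OF evR] unit_mult P_unit by (metis ev_simps(4))
        moreover have "ev G * ev (U * U') = cx p ^ Suc n * ev V'"
        proof -
          have "ev G * ev (U * U') = (ev G * ev U) * ev U'" by (simp add: ev_simps mult.assoc)
          also have "\<dots> = cx p ^ n * (ev V * ev U')" by (simp only: UV(2) mult.assoc)
          also have "\<dots> = cx p ^ Suc n * ev V'" by (simp add: U'(2))
          finally show ?thesis .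
        qed
        ultimately show ?thesis by blast
      qed simp
    qed
    from this[of "Suc k"] have D
    proof
      assume "\<exists>U V. ev U \<notin> P \<and> ev G * ev U = cx p ^ Suc k * ev V"
      then obtain U V where UV: "ev U \<notin> P" "ev G * ev U = cx p ^ Suc k * ev V" by blast
      have "cx p ^ k * (cx c' * ev U) = ev G * ev H * ev U"
        using c(2) by (simp add: k cx_simps)
      also have "\<dots> = (ev G * ev U) * ev H" by (simp add: mult_ac)
      also have "\<dots> = cx p ^ k * (cx p * (ev V * ev H))" unfolding UV(2) by (simp add: mult_ac)
      finally have "cx c' * ev U = cx p * (ev V * ev H)" using cp0 by simp
      then have "cx c' * ev U \<in> P" using P_mult2[OF pP mult[OF evR evR]] by simp
      moreover have "cx c' \<notin> P" using pdvd k(2) by blast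
      ultimately show D using UV(1) unit_or_P[OF evR] unit_or_P[OF cxR] unit_mult P_unit by blast
    qed simp
    then obtain i U V where UV: "ev U \<notin> P" "ev V \<notin> P" "ev G * ev U = cx p ^ i * ev V"
      unfolding D_def by blast
    then have u: "ev U \<in> ring_units R" "ev V \<in> ring_units R" using unit_or_P[OF evR] by blast+
    have "ev G = cx p powi (int i) * (ev V * inverse (ev U))"
      using UV(3) unit_nz[OF u(1)] by (simp add: field_simps)
    then show ?thesis using unit_mult[OF u(2) unit_inverse[OF u(1)]] unfolding has_ord_def by blast
  qed
  have "\<exists>n. has_ord R (cx p) z n" if z: "z \<in> F" "z \<noteq> 0" for z
  proof -
    obtain G H where GH: "ev H \<noteq> 0" "z = ev G / ev H" using F_fraction z by blast
    then show ?thesis using main[of G] main[of H] has_ord_divide[OF cp0] z by fastforce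
  qed
  then show ?thesis using pP cp0 by blast
qed

text \<open>Three cases: x has a pole, some x - emb(\<alpha> k) lies in the maximal ideal, or
  neither. Explicit orders settle the first two.\<close>

lemma place_discrete:
  assumes V: "val_ring K F R"
  shows "\<exists>t\<in>val_ring.P R. t \<noteq> 0 \<and> (\<forall>z\<in>F. z \<noteq> 0 \<longrightarrow> (\<exists>n. has_ord R t z n))"
proof -
  have T: ?thesis if "totram R t N e" for t N e
    using that totram_ord[OF that] unfolding totram_def by blast
  obtain t where t: "\<And>R. val_ring K F R \<Longrightarrow> x \<notin> R \<Longrightarrow> totram R t (\<lambda>g. - int (degree g)) (- int r)"
    using totram_infinity by blast
  show ?thesis
    using T t[OF V] totram_finite[OF V] unramified_discrete[OF V] by blast
qed

lemma place_val_ring_iff: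
  assumes V: "val_ring K F R" and z: "z \<in> F" "z \<noteq> 0"
  shows "z \<in> R \<longleftrightarrow> 0 \<le> place_val F (val_ring.P R) z"
    and "z \<in> val_ring.P R \<longleftrightarrow> 0 < place_val F (val_ring.P R) z"
proof -
  interpret val_ring K F R by (rule V)
  obtain t where t: "t \<in> P" "t \<noteq> 0" "\<And>z. z \<in> F \<Longrightarrow> z \<noteq> 0 \<Longrightarrow> \<exists>n. has_ord R t z n"
    using place_discrete[OF V] by blast
  obtain n where n: "has_ord R t z n" using t(3)[OF z] by blast
  show "z \<in> R \<longleftrightarrow> 0 \<le> place_val F P z" "z \<in> P \<longleftrightarrow> 0 < place_val F P z"
    using place_val_eq[OF t n] has_ord_R_iff[OF t(1,2) n] has_ord_P_iff[OF t(1,2) n] by auto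
qed

end

section \<open>Functions with poles at ramified places only\<close>

text \<open>Index 0 is the place at infinity, index k the zero of x - emb(\<alpha> k). The places
  are carried by their valuation rings, and their position over K(x) is stated as membership, which
  does not presuppose discreteness.\<close>

locale kummer_places = kummer emb x y \<alpha> m r f
  for emb :: "'k::{field,finite} \<Rightarrow> 'a::field" and x y :: 'a
    and \<alpha> :: "nat \<Rightarrow> 'k" and m r :: nat and f :: "'k poly" +
  fixes RR :: "nat \<Rightarrow> 'a set"
  assumes RR_0: "val_ring K F (RR 0)" "x \<notin> RR 0"
    and RR_k: "k \<in> {1..r} \<Longrightarrow> val_ring K F (RR k)"
      "k \<in> {1..r} \<Longrightarrow> x - emb (\<alpha> k) \<in> val_ring.P (RR k)"
begin

section \<open>Orders at the chosen ramified places\<close>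

definition tinf where "tinf = (SOME t. \<forall>R. val_ring K F R \<longrightarrow> x \<notin> R \<longrightarrow> totram R t (\<lambda>g. - int (degree g)) (- int r))"

lemma tinf: "val_ring K F R \<Longrightarrow> x \<notin> R \<Longrightarrow> totram R tinf (\<lambda>g. - int (degree g)) (- int r)"
proof -
  have "\<exists>t. \<forall>R. val_ring K F R \<longrightarrow> x \<notin> R \<longrightarrow> totram R t (\<lambda>g. - int (degree g)) (- int r)"
    using totram_infinity by blast
  from someI_ex[OF this] show "val_ring K F R \<Longrightarrow> x \<notin> R \<Longrightarrow> totram R tinf (\<lambda>g. - int (degree g)) (- int r)"
    unfolding tinf_def by blast
qed

definition unif :: "nat \<Rightarrow> 'a" where "unif k = (if k = 0 then tinf else y)"

definition ord_poly :: "nat \<Rightarrow> 'k poly \<Rightarrow> int" where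
  "ord_poly k g = (if k = 0 then - int (degree g) else int (order (\<alpha> k) g))"

definition ord_y :: "nat \<Rightarrow> int" where "ord_y k = (if k = 0 then - int r else 1)"

lemma totram_RR: "k \<le> r \<Longrightarrow> totram (RR k) (unif k) (ord_poly k) (ord_y k)"
  using tinf[OF RR_0] totram_finite[OF RR_k(1) _ RR_k(2), of k]
  by (cases "k = 0") (simp_all add: unif_def ord_poly_def[abs_def] ord_y_def)

lemma val_ring_RR: "k \<le> r \<Longrightarrow> val_ring K F (RR k)"
  using totram_RR by (auto simp: totram_def)

lemma unif: "k \<le> r \<Longrightarrow> unif k \<noteq> 0" "k \<le> r \<Longrightarrow> unif k \<in> val_ring.P (RR k)"
  using totram_RR by (auto simp: totram_def)

text \<open>Both rings carry the same uniformizer and the same orders of polynomials and of y, and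
  these data determine the ring.\<close>

lemma RR_unique:
  assumes V: "val_ring K F R"
  shows "x \<notin> R \<Longrightarrow> R = RR 0" and "k \<in> {1..r} \<Longrightarrow> x - emb (\<alpha> k) \<in> val_ring.P R \<Longrightarrow> R = RR k"
proof -
  show "R = RR 0" if "x \<notin> R" using totram_unique[OF tinf[OF V that] tinf[OF RR_0]] .
  show "R = RR k" if "k \<in> {1..r}" "x - emb (\<alpha> k) \<in> val_ring.P R"
    using totram_unique[OF totram_finite[OF V that] totram_finite[OF RR_k(1) that(1) RR_k(2)]] that(1) by blast
qed

lemma x_in_RR: "k \<in> {1..r} \<Longrightarrow> x \<in> RR k"
proof -
  assume k: "k \<in> {1..r}"
  interpret val_ring K F "RR k" using RR_k(1)[OF k] .
  show ?thesis using add[OF P_R[OF RR_k(2)[OF k]], of "emb (\<alpha> k)"] K_sub by auto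
qed

lemma RR_inj: "inj_on RR {..r}"
proof (rule inj_onI)
  fix j k assume jk: "j \<in> {..r}" "k \<in> {..r}" and eq: "RR j = RR k"
  have 0: "j = 0 \<longleftrightarrow> k = 0" using jk x_in_RR[of j] x_in_RR[of k] RR_0 eq by (metis Suc_leI atLeastAtMost_iff atMost_iff gr0I One_nat_def)
  show "j = k"
  proof (cases "j = 0")
    case False
    then have jk': "j \<in> {1..r}" "k \<in> {1..r}" using 0 jk by auto
    interpret val_ring K F "RR k" using RR_k(1)[OF jk'(2)] .
    have "(x - emb (\<alpha> k)) - (x - emb (\<alpha> j)) \<in> P"
      using P_diff[OF RR_k(2)[OF jk'(2)] RR_k(2)[OF jk'(1), unfolded eq]] by simp
    then have "emb (\<alpha> j - \<alpha> k) \<in> P" by (simp add: emb_simps)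
    then have "\<alpha> j - \<alpha> k = 0" using unit_emb[OF RR_k(1)[OF jk'(2)]] P_unit by blast
    then show ?thesis using alpha_injD jk' by simp
  qed (use 0 in simp)
qed

definition ord_at :: "nat \<Rightarrow> 'a \<Rightarrow> int" where "ord_at k z = place_val F (val_ring.P (RR k)) z"

lemma ord_at_eq:
  assumes k: "k \<le> r" and h: "has_ord (RR k) (unif k) z n" shows "ord_at k z = n"
proof -
  interpret val_ring K F "RR k" using val_ring_RR[OF k] .
  show ?thesis unfolding ord_at_def
    using place_val_eq[OF unif(2,1)[OF k] _ h] totram_ord[OF totram_RR[OF k]] totram_RR[OF k] by blast
qed

lemma has_ord_ord_at:
  assumes k: "k \<le> r" and z: "z \<in> F" "z \<noteq> 0" shows "has_ord (RR k) (unif k) z (ord_at k z)"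
  using totram_ord[OF totram_RR[OF k] z] totram_RR[OF k] ord_at_eq[OF k] by blast

lemma has_ord_linear:
  assumes k: "k \<le> r" and j: "j \<in> {1..r}"
  shows "has_ord (RR k) (unif k) (x - emb (\<alpha> j)) (if k = 0 then - int m else if j = k then int m else 0)"
proof -
  have "order (\<alpha> k) [:- \<alpha> j, 1:] = (if j = k then 1 else 0)" if "k \<noteq> 0"
    using alpha_injD[of j k] that k j order_power_n_n[of "\<alpha> k" 1] order_root[of "[:- \<alpha> j, 1:]" "\<alpha> k"] by auto
  then have "int m * ord_poly k [:- \<alpha> j, 1:] = (if k = 0 then - int m else if j = k then int m else 0)"
    by (simp add: ord_poly_def)
  moreover have "has_ord (RR k) (unif k) (cx [:- \<alpha> j, 1:]) (int m * ord_poly k [:- \<alpha> j, 1:])"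
    using totram_RR[OF k] by (simp add: totram_def)
  ultimately show ?thesis by (simp add: cx_linear)
qed

text \<open>If z were not in K[x][1/z], some valuation ring containing K[x] would omit z. The
  resulting relation is an integral equation for z over K[x] in disguise: multiply by a power of
  z.\<close>

lemma regular_adjoin:
  assumes z: "z \<in> F" "z \<noteq> 0" and reg: "\<And>R. val_ring K F R \<Longrightarrow> x \<in> R \<Longrightarrow> z \<in> R"
  shows "\<exists>H. z = poly (map_poly cx H) (inverse z)"
proof -
  have "z \<in> adjoin (range cx) (inverse z)"
  proof (rule ccontr)
    assume n: "z \<notin> adjoin (range cx) (inverse z)"
    have A: "is_subring (range cx)"
      unfolding is_subring_def by (auto simp: cx_simps(2,4,6)[symmetric] intro: rev_image_eqI)
    have "emb c \<in> range cx" for c using cx_const[of c] by (metis rangeI)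
    moreover have xx: "x \<in> range cx" using cx_X by (metis rangeI)
    moreover have "x \<notin> K"
    proof
      assume "x \<in> K"
      then obtain c where "cx [:- c, 1:] = 0" by (auto simp: cx_linear)
      then show False by (simp add: cx_eq_0)
    qed
    ultimately have K: "K \<subset> range cx" by auto
    obtain R where R: "is_valuation_ring K F R" "range cx \<subseteq> R" "z \<notin> R"
      using exists_valuation_ring[OF F_subfield A K _ z n] cx_F by auto
    have "val_ring K F R" using R F_subfield by unfold_locales
    then show False using reg R xx by blast
  qed
  then obtain p where p: "z = poly p (inverse z)" "\<forall>i. coeff p i \<in> range cx" unfolding adjoin_def by auto
  then have "\<forall>i. \<exists>g. coeff p i = cx g" by blast
  then obtain h where h: "\<And>i. coeff p i = cx (h i)" by metis
  define H where "H = (\<Sum>i\<le>degree p. monom (h i) i)"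
  have ph: "p = map_poly cx H"
  proof (rule poly_eqI)
    fix n show "coeff p n = coeff (map_poly cx H) n"
      using coeff_eq_0[of p n]
      by (cases "n \<le> degree p") (auto simp: H_def coeff_map_poly cx_simps coeff_sum h)
  qed
  show ?thesis by (rule exI) (rule p(1)[unfolded ph])
qed

text \<open>\<open>K[x, y]\<close> is integrally closed.\<close>

lemma regular_imp_range_ev:
  assumes z: "z \<in> F" and reg: "\<And>R. val_ring K F R \<Longrightarrow> x \<in> R \<Longrightarrow> z \<in> R"
  shows "z \<in> range ev"
proof -
  have "\<exists>c. c \<noteq> 0 \<and> cx c * z \<in> range ev"
  proof -
    obtain G H where GH: "ev H \<noteq> 0" "z = ev G / ev H" using F_fraction[OF z] by blast
    obtain H' c where c: "c \<noteq> 0" "ev H * ev H' = cx c" using norm_exists[OF GH(1)] by blast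
    have "cx c * z = ev (G * H')" using GH by (simp add: c(2)[symmetric] ev_simps)
    then show ?thesis using c by blast
  qed
  then obtain b where "b \<noteq> 0 \<and> cx b * z \<in> range ev" ..
  from ex_has_least_nat[of "\<lambda>c. c \<noteq> 0 \<and> cx c * z \<in> range ev", OF this, of degree]
  obtain c where c: "c \<noteq> 0" "cx c * z \<in> range ev"
    and min: "\<And>d. d \<noteq> 0 \<Longrightarrow> cx d * z \<in> range ev \<Longrightarrow> degree c \<le> degree d" by auto
  show ?thesis
  proof (cases "degree c = 0")
    case True
    then obtain a where a: "c = [:a:]" by (rule degree_eq_zeroE)
    then have "cx [:inverse a:] * (cx c * z) = z" using c(1)
      by (simp add: a cx_const mult.assoc[symmetric] emb_simps(2) emb_simps(4)[symmetric])
    moreover obtain G where "cx c * z = ev G" using c(2) by blast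
    ultimately have "z = ev (smult [:inverse a:] G)" by (simp add: ev_smult)
    then show ?thesis by blast
  next
    case False
    \<comment> \<open>A denominator of positive degree can be shortened: for a prime factor p of c,
      all coefficients of the polynomial G representing p w turn out divisible by p, so c / p is a
      denominator too.\<close>
    then obtain p where p: "prime_elem p" "p dvd c" "degree p > 0" using exists_prime_elem_dvd by blast
    then obtain c0 where c0: "c = p * c0" by (auto elim: dvdE)
    have c0n: "c0 \<noteq> 0" "degree c0 < degree c" using c0 c p by (auto simp: degree_mult_eq)
    have cp0: "cx p \<noteq> 0" using c c0 cx_eq_0 by auto
    define w where "w = cx c0 * z"
    have wF: "w \<in> F" unfolding w_def using subring_mult[OF F_subring cx_F z] .
    have wreg: "w \<in> R" if "val_ring K F R" "x \<in> R" for R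
    proof -
      interpret val_ring K F R by fact
      show ?thesis unfolding w_def using mult cx_in[OF subring K_sub that(2)] reg that by blast
    qed
    obtain G0 where "cx p * w = ev G0"
      using c(2) by (auto simp: c0 w_def cx_simps(4) mult.assoc)
    then obtain G where G: "degree G < m" "ev G = cx p * w" using reduce[of G0] by auto
    have "p dvd coeff G i" for i
    proof (cases "w = 0")
      case True
      then have "G = 0" using G indep by fastforce
      then show ?thesis by simp
    next
      case w0: False
      show ?thesis
      proof (cases "p dvd f")
        case True
        \<comment> \<open>Here p is a constant multiple of X - \<alpha> k. As w is regular at
          \<open>RR k\<close>, ev G has order at least m there, whereas the i-th summand has order i
          < m plus m times the order of its coefficient; so each coefficient vanishes at \<alpha>
          k.\<close>
        then obtain k where k: "k \<in> {1..r}" "p dvd [:- \<alpha> k, 1:]"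
          using prime_elem_dvd_prodE[OF p(1)] unfolding f_def by blast
        then obtain e where e: "[:- \<alpha> k, 1:] = p * e" by (auto elim: dvdE)
        have "degree [:- \<alpha> k, 1:] = 1" by simp
        have e0: "e \<noteq> 0" using e by auto
        moreover have "p \<noteq> 0" using p(3) by auto
        ultimately have "degree e = 0"
          using p(3) degree_mult_eq[of p e] \<open>degree [:- \<alpha> k, 1:] = 1\<close> unfolding e by simp
        then obtain b where b: "e = [:b:]" "b \<noteq> 0" using e0 by (auto elim: degree_eq_zeroE)
        have kr: "k \<le> r" using k by simp
        interpret val_ring K F "RR k" using RR_k(1)[OF k(1)] .
        note t = unif(2,1)[OF kr]
        have "cx e \<in> ring_units (RR k)" unfolding b cx_const using unit_emb[OF RR_k(1)[OF k(1)] b(2)] .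
        then have "has_ord (RR k) (unif k) (cx e) 0" by (rule has_ord_unit)
        then have "has_ord (RR k) (unif k) ((x - emb (\<alpha> k)) * w / cx e) (int m + ord_at k w - 0)"
          using has_ord_linear[OF kr k(1)] k(1) has_ord_ord_at[OF kr wF w0]
          by (intro has_ord_mult has_ord_divide t) auto
        moreover have "(x - emb (\<alpha> k)) * w / cx e = ev G"
          using e0 cx_eq_0[of e] by (simp add: cx_linear[symmetric] e G cx_simps(4) del: mult_pCons_right)
        ultimately have o: "has_ord (RR k) (unif k) (ev G) (int m + ord_at k w)" by simp
        have "ord_at k w \<ge> 0"
          using has_ord_R_iff[OF t has_ord_ord_at[OF kr wF w0]] wreg[OF RR_k(1) x_in_RR] k(1) by blast
        moreover have G0: "G \<noteq> 0" using G cp0 w0 by (auto simp: ev_simps)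
        then have "ev_ord (ord_poly k) (ord_y k) G = int m + ord_at k w"
          using has_ord_unique[OF t totram_ev[OF totram_RR[OF kr] G0 G(1)] o] by simp
        ultimately have ge: "int m \<le> ev_ord (ord_poly k) (ord_y k) G" by simp
        show ?thesis
        proof (cases "coeff G i = 0")
          case nz: False
          then have "ev_ord (ord_poly k) (ord_y k) G \<le> term_ord (ord_poly k) (ord_y k) G i"
            unfolding ev_ord_def using finite_support by (intro Min_le) auto
          then have "int m \<le> int m * int (order (\<alpha> k) (coeff G i)) + int i"
            using ge k(1) by (simp add: term_ord_def ord_poly_def ord_y_def)
          moreover have "i < m" using nz G(1) le_degree[OF nz] by simp
          ultimately have "order (\<alpha> k) (coeff G i) \<noteq> 0" by (intro notI) simp
          then have "[:- \<alpha> k, 1:] dvd coeff G i" by (metis order_root poly_eq_0_iff_dvd)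
          then show ?thesis using k(2) dvd_trans by blast
        qed simp
      next
        case nf: False
        \<comment> \<open>Multiplying the integral equation of w by p^(n+1) exhibits (p w)^(n+1) as
          p times an element of K[x, y], so reducedness modulo p applies to ev G = p w.\<close>
        obtain H where H: "w = poly (map_poly cx H) (inverse w)" using regular_adjoin[OF wF w0 wreg] by blast
        define n where "n = degree H"
        have "w = (\<Sum>j\<le>n. cx (coeff H j) * inverse w ^ j)"
        proof -
          have "degree (map_poly cx H) = n" unfolding n_def
            by (rule degree_map_poly) (simp add: cx_eq_0)
          then show ?thesis using H by (simp add: poly_altdef coeff_map_poly cx_simps)
        qed
        then have "w * w ^ n = (\<Sum>j\<le>n. cx (coeff H j) * (inverse w ^ j * w ^ n))"
          by (metis (no_types, lifting) sum_distrib_right mult.assoc sum.cong)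
        also have "\<dots> = (\<Sum>j\<le>n. cx (coeff H j) * w ^ (n - j))"
          using w0 by (intro sum.cong) (auto simp: power_diff field_simps)
        finally have "ev G ^ Suc n = cx p ^ Suc n * (\<Sum>j\<le>n. cx (coeff H j) * w ^ (n - j))"
          by (simp add: G power_mult_distrib)
        also have "\<dots> = cx p * (\<Sum>j\<le>n. cx (coeff H j) * cx p ^ n * w ^ (n - j))"
          by (simp add: sum_distrib_left mult_ac)
        also have "(\<Sum>j\<le>n. cx (coeff H j) * cx p ^ n * w ^ (n - j)) = (\<Sum>j\<le>n. ev (smult (coeff H j * p ^ j) (G ^ (n - j))))"
        proof (rule sum.cong)
          fix j assume "j \<in> {..n}"
          then have "cx p ^ n = cx p ^ j * cx p ^ (n - j)" by (simp flip: power_add)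
          then show "cx (coeff H j) * cx p ^ n * w ^ (n - j) = ev (smult (coeff H j * p ^ j) (G ^ (n - j)))"
            by (simp add: ev_smult ev_simps cx_simps G power_mult_distrib mult_ac)
        qed simp
        finally have "ev G ^ Suc n = cx p * ev (\<Sum>j\<le>n. smult (coeff H j * p ^ j) (G ^ (n - j)))"
          by (simp add: hom_sum[OF ev_hom])
        then show ?thesis using reduced_mod_prime[OF p(1) nf G(1)] by blast
      qed
    qed
    then obtain V where "G = smult p V" using exists_smult_eq by blast
    then have "w = ev V" using G(2) cp0 by (simp add: ev_smult)
    then show ?thesis using min[OF c0n(1)] c0n(2) unfolding w_def by fastforce
  qed
qed

text \<open>Absence of other poles is phrased with valuation rings instead of
  \<open>place_val\<close>, in the form that the integrality argument consumes;
  \<open>pole_divisor_iff\<close> translates.\<close>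

definition reg :: "nat \<Rightarrow> 'a \<Rightarrow> bool" where
  "reg s z \<longleftrightarrow> z \<in> F \<and> z \<noteq> 0 \<and> (\<forall>R. val_ring K F R \<longrightarrow> R \<notin> RR ` {..s} \<longrightarrow> z \<in> R)"

definition den :: "nat \<Rightarrow> 'k poly" where "den s = (\<Prod>k=1..s. [:- \<alpha> k, 1:])"

lemma cx_den: "cx (den s) = (\<Prod>k=1..s. x - emb (\<alpha> k))"
  unfolding den_def by (simp only: cx_simps cx_linear)

lemma cx_den_nz: "cx (den s) \<noteq> 0"
  unfolding cx_eq_0 den_def by simp

lemma has_ord_den:
  assumes k: "k \<le> s" and s: "s \<le> r"
  shows "has_ord (RR k) (unif k) (cx (den s)) (if k = 0 then - int (m * s) else int m)"
proof -
  have kr: "k \<le> r" using k s by simp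
  interpret val_ring K F "RR k" using val_ring_RR[OF kr] .
  have "has_ord (RR k) (unif k) (cx (den s)) (\<Sum>j=1..s. if k = 0 then - int m else if j = k then int m else 0)"
    unfolding cx_den using s by (intro has_ord_prod unif(1)[OF kr] has_ord_linear[OF kr]) auto
  also have "(\<Sum>j=1..s. if k = 0 then - int m else if j = k then int m else 0) = (if k = 0 then - int (m * s) else int m)"
    using k by (auto simp: mult.commute)
  finally show ?thesis .
qed

lemma reg_units:
  assumes V: "val_ring K F R" and R: "R \<notin> RR ` {..s}" and s: "s \<le> r"
  shows "x \<in> R" "y \<in> R" "k \<in> {1..s} \<Longrightarrow> x - emb (\<alpha> k) \<in> ring_units R"
proof -
  interpret val_ring K F R by (rule V)
  show xR: "x \<in> R" using RR_unique(1)[OF V] R by auto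
  then show "y \<in> R" using integrally_closed[OF F_gens(3) _ m] cx_in[OF subring K_sub] y_eq by metis
  assume k: "k \<in> {1..s}"
  then have "x - emb (\<alpha> k) \<notin> P" using RR_unique(2)[OF V, of k] R s by auto
  moreover have "x - emb (\<alpha> k) \<in> R" using diff[OF xR] K_sub by blast
  ultimately show "x - emb (\<alpha> k) \<in> ring_units R" using unit_or_P by blast
qed

text \<open>\<open>N\<close> exceeds or equals every pole order, and the denominator has order m >=
  1 at each \<open>RR k\<close> with k > 0, so all finite poles are cleared. The pole at infinity is
  harmless, because integral closedness only tests rings containing x.\<close>

lemma reg_decomp:
  assumes z: "reg s z" and s: "s \<le> r"
  obtains N G where "G \<noteq> 0" "degree G < m" "z = ev G / cx (den s) ^ N"
proof -
  have zF: "z \<in> F" "z \<noteq> 0" using z by (auto simp: reg_def)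
  define N where "N = (\<Sum>k\<le>s. nat (- ord_at k z))"
  have "cx (den s) ^ N * z \<in> range ev"
  proof (rule regular_imp_range_ev)
    show "cx (den s) ^ N * z \<in> F" using cx_F zF F_subring by (auto intro: subring_mult subring_power)
    fix R assume V: "val_ring K F R" and xR: "x \<in> R"
    interpret val_ring K F R by (rule V)
    show "cx (den s) ^ N * z \<in> R"
    proof (cases "R \<in> RR ` {..s}")
      case True
      then obtain k where k: "k \<le> s" "R = RR k" by auto
      then have k0: "k \<noteq> 0" and kr: "k \<le> r" using xR RR_0(2) s by (metis, simp)
      note t = unif(2,1)[OF kr, folded k(2)]
      have "has_ord R (unif k) (cx (den s) ^ N * z) (int N * int m + ord_at k z)"
        using has_ord_mult[OF t(2) has_ord_power[OF t(2)]] has_ord_den[OF k(1) s] has_ord_ord_at[OF kr zF] k(2) k0 by auto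
      moreover have "nat (- ord_at k z) \<le> N" unfolding N_def using k(1) by (intro member_le_sum) auto
      moreover have "int N \<le> int N * int m" using m mult_left_mono[of 1 "int m" "int N"] by simp
      ultimately show ?thesis using has_ord_R_iff[OF t, of "cx (den s) ^ N * z" "int N * int m + ord_at k z"] by linarith
    next
      case False
      then show ?thesis using z V cx_in[OF subring K_sub xR] unfolding reg_def by (auto intro: mult power)
    qed
  qed
  then obtain G where G: "degree G < m" "cx (den s) ^ N * z = ev G" using reduce by (metis imageE)
  have "z = ev G / cx (den s) ^ N" using cx_den_nz by (simp add: G(2)[symmetric])
  moreover have "G \<noteq> 0" using G(2) zF cx_den_nz by (auto simp: ev_simps)
  ultimately show ?thesis using that G(1) by blast
qed

definition summand :: "nat \<Rightarrow> nat \<Rightarrow> 'k poly \<Rightarrow> nat \<Rightarrow> 'a" where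
  "summand s N g i = cx g * y ^ i / cx (den s) ^ N"

lemma reg_summand:
  assumes g: "g \<noteq> 0" and s: "s \<le> r" shows "reg s (summand s N g i)"
  unfolding reg_def
proof (intro conjI allI impI)
  show "summand s N g i \<in> F" unfolding summand_def
    using cx_F F_gens F_subring F_subfield by (intro subfield_divide subring_mult subring_power) auto
  show "summand s N g i \<noteq> 0" unfolding summand_def using cx_den_nz g y_nz by (simp add: cx_eq_0)
  fix R assume V: "val_ring K F R" and R: "R \<notin> RR ` {..s}"
  interpret val_ring K F R by (rule V)
  note u = reg_units[OF V R s]
  have "cx (den s) \<in> ring_units R" unfolding cx_den
    using u(3) by (rule unit_prod)
  then have "inverse (cx (den s) ^ N) \<in> R" using unit_R[OF unit_inverse[OF unit_power]] by blast
  then show "summand s N g i \<in> R" unfolding summand_def divide_inverse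
    using cx_in[OF subring K_sub u(1)] u(2) by (intro mult power)
qed

lemma ord_at_summand:
  assumes g: "g \<noteq> 0" and s: "s \<le> r" and k: "k \<le> s"
  shows "ord_at k (summand s N g i) = (if k = 0 then int m * int s * int N - int m * int (degree g) - int r * int i
     else int m * (int (order (\<alpha> k) g) - int N) + int i)"
proof -
  have kr: "k \<le> r" using k s by simp
  interpret val_ring K F "RR k" using val_ring_RR[OF kr] .
  note T = totram_RR[OF kr, unfolded totram_def]
  have "has_ord (RR k) (unif k) (summand s N g i) ((int m * ord_poly k g + int i * ord_y k) - int N * (if k = 0 then - int (m * s) else int m))"
    unfolding summand_def using T g
    by (intro has_ord_divide has_ord_mult has_ord_power has_ord_den[OF k s]) auto
  then show ?thesis using ord_at_eq[OF kr] by (auto simp: ord_poly_def ord_y_def algebra_simps)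
qed

text \<open>Division by the common denominator shifts the orders of all summands equally, so the
  order of the sum remains their minimum.\<close>

lemma ord_at_min:
  assumes G: "G \<noteq> 0" "degree G < m" and s: "s \<le> r" and k: "k \<le> s"
  shows "\<And>i. coeff G i \<noteq> 0 \<Longrightarrow> ord_at k (ev G / cx (den s) ^ N) \<le> ord_at k (summand s N (coeff G i) i)"
    and "\<exists>i. coeff G i \<noteq> 0 \<and> ord_at k (ev G / cx (den s) ^ N) = ord_at k (summand s N (coeff G i) i)"
proof -
  have kr: "k \<le> r" using k s by simp
  interpret val_ring K F "RR k" using val_ring_RR[OF kr] .
  let ?d = "int N * (if k = 0 then - int (m * s) else int m)"
  have 1: "has_ord (RR k) (unif k) (ev G / cx (den s) ^ N) (ev_ord (ord_poly k) (ord_y k) G - ?d)"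
    using totram_ev[OF totram_RR[OF kr] G] unif(1)[OF kr]
    by (intro has_ord_divide has_ord_power has_ord_den[OF k s]) auto
  have 2: "has_ord (RR k) (unif k) (summand s N (coeff G i) i) (term_ord (ord_poly k) (ord_y k) G i - ?d)"
    if "coeff G i \<noteq> 0" for i
    unfolding summand_def using totram_term[OF totram_RR[OF kr] that] unif(1)[OF kr]
    by (intro has_ord_divide has_ord_power has_ord_den[OF k s]) auto
  note p = ord_at_eq[OF kr 1] ord_at_eq[OF kr 2]
  show "ord_at k (ev G / cx (den s) ^ N) \<le> ord_at k (summand s N (coeff G i) i)" if "coeff G i \<noteq> 0" for i
    using p that finite_support[of G] unfolding ev_ord_def by auto
  have "ev_ord (ord_poly k) (ord_y k) G \<in> term_ord (ord_poly k) (ord_y k) G ` {i. coeff G i \<noteq> 0}"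
    unfolding ev_ord_def using finite_support support_nonempty[OF G(1)] by (intro Min_in) auto
  then show "\<exists>i. coeff G i \<noteq> 0 \<and> ord_at k (ev G / cx (den s) ^ N) = ord_at k (summand s N (coeff G i) i)"
    using p by auto
qed

end

section \<open>The minimal generating set\<close>

context kummer_places
begin

definition places :: "nat \<Rightarrow> 'a set list" where
  "places s = map (\<lambda>k. val_ring.P (RR k)) [0..<s+1]"

definition pole :: "nat \<Rightarrow> 'a \<Rightarrow> nat list" where
  "pole s z = map (\<lambda>k. nat (- ord_at k z)) [0..<s+1]"

lemma length_pole: "length (pole s z) = s + 1"
  by (simp add: pole_def)

lemma nth_pole: "k \<le> s \<Longrightarrow> pole s z ! k = nat (- ord_at k z)"
  by (simp add: pole_def del: upt_Suc)

lemma val_ring_P_inj: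
  assumes "val_ring K F R" "val_ring K F R'" "val_ring.P R = val_ring.P R'" shows "R = R'"
  using val_ring.place_ring_P[OF assms(1)] val_ring.place_ring_P[OF assms(2)] assms(3) by metis

lemma divisor_of_places:
  assumes s: "s \<le> r" and R: "val_ring K F R"
  shows "k \<le> s \<Longrightarrow> R = RR k \<Longrightarrow> divisor_of (places s) ns (val_ring.P R) = int (ns ! k)"
    and "R \<notin> RR ` {..s} \<Longrightarrow> divisor_of (places s) ns (val_ring.P R) = 0"
proof -
  have nth: "places s ! j = val_ring.P (RR j)" if "j < s + 1" for j
    using that by (simp add: places_def del: upt_Suc)
  have eq: "val_ring.P R = places s ! j \<longleftrightarrow> R = RR j" if "j < s + 1" for j
    using val_ring_P_inj[OF R val_ring_RR[of j]] s that nth by auto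
  have d: "divisor_of (places s) ns (val_ring.P R) = (\<Sum>j<s+1. if R = RR j then int (ns ! j) else 0)"
    unfolding divisor_of_def using eq by (intro sum.cong) (auto simp: places_def)
  show "divisor_of (places s) ns (val_ring.P R) = int (ns ! k)" if k: "k \<le> s" "R = RR k"
  proof -
    have "R = RR j \<longleftrightarrow> j = k" if "j \<in> {..<s+1}" for j
      using inj_onD[OF RR_inj, of j k] that k s by auto
    then have "(\<Sum>j<s+1. if R = RR j then int (ns ! j) else 0) = (\<Sum>j<s+1. if j = k then int (ns ! j) else 0)"
      by (intro sum.cong) auto
    then show ?thesis using d k by simp
  qed
  show "divisor_of (places s) ns (val_ring.P R) = 0" if "R \<notin> RR ` {..s}"
  proof -
    have "R \<noteq> RR j" if "j \<in> {..<s+1}" for j using that \<open>R \<notin> RR ` {..s}\<close> by auto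
    then show ?thesis unfolding d by (intro sum.neutral) auto
  qed
qed

text \<open>Divisors are functions on all sets, so equality is tested in three ways: listed places
  give the entries of the tuple, other places give regularity, and on sets that are not places both
  sides vanish.\<close>

lemma pole_divisor_iff:
  assumes s: "s \<le> r" and z: "z \<in> F" "z \<noteq> 0" and len: "length ns = s + 1"
  shows "pole_divisor K F z = divisor_of (places s) ns \<longleftrightarrow> reg s z \<and> ns = pole s z"
proof -
  have pd: "pole_divisor K F z (val_ring.P R) = int (nat (- place_val F (val_ring.P R) z))"
    if "val_ring K F R" for R
    using val_ring.P_place[OF that] by (simp add: pole_divisor_def)
  have pdk: "pole_divisor K F z (val_ring.P (RR k)) = int (nat (- ord_at k z))" if "k \<le> s" for k
    unfolding ord_at_def using pd[OF val_ring_RR] that s by simp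
  show ?thesis
  proof
    assume eq: "pole_divisor K F z = divisor_of (places s) ns"
    have "ns = pole s z"
    proof (rule nth_equalityI)
      show "length ns = length (pole s z)" by (simp add: len length_pole)
      fix k assume "k < length ns"
      then have k: "k \<le> s" using len by simp
      have "int (ns ! k) = int (nat (- ord_at k z))"
        using pdk[OF k] divisor_of_places(1)[OF s val_ring_RR k, of k ns] k s eq by simp
      then show "ns ! k = pole s z ! k" unfolding nth_pole[OF k] of_nat_eq_iff .
    qed
    moreover have "z \<in> R" if V: "val_ring K F R" and R: "R \<notin> RR ` {..s}" for R
    proof -
      have "int (nat (- place_val F (val_ring.P R) z)) = 0"
        using pd[OF V] divisor_of_places(2)[OF s V R, of ns] eq by simp
      then have "0 \<le> place_val F (val_ring.P R) z" by linarith
      then show ?thesis using place_val_ring_iff(1)[OF V z] by blast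
    qed
    ultimately show "reg s z \<and> ns = pole s z" using z by (simp add: reg_def)
  next
    assume a: "reg s z \<and> ns = pole s z"
    show "pole_divisor K F z = divisor_of (places s) ns"
    proof
      fix P show "pole_divisor K F z P = divisor_of (places s) ns P"
      proof (cases "is_place K F P")
        case True
        then obtain R where V: "val_ring K F R" and P: "P = val_ring.P R"
          using place_val_ring[OF F_subfield] by metis
        show ?thesis
        proof (cases "R \<in> RR ` {..s}")
          case True
          then obtain k where k: "k \<le> s" "R = RR k" by auto
          show ?thesis unfolding P divisor_of_places(1)[OF s V k]
            using pdk[OF k(1)] k nth_pole[OF k(1), of z] a by simp
        next
          case False
          then have "z \<in> R" using a V unfolding reg_def by blast
          then have "place_val F P z \<ge> 0" unfolding P using place_val_ring_iff(1)[OF V z] by blast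
          then show ?thesis unfolding P divisor_of_places(2)[OF s V False] using pd[OF V] by simp
        qed
      next
        case False
        have "P \<noteq> places s ! j" if "j < length (places s)" for j
        proof
          assume "P = places s ! j"
          then have "P = val_ring.P (RR j)" using that by (simp add: places_def del: upt_Suc)
          then show False using val_ring.P_place[OF val_ring_RR[of j]] that s False by (simp add: places_def)
        qed
        then have "divisor_of (places s) ns P = 0" unfolding divisor_of_def by (intro sum.neutral) auto
        then show ?thesis using False by (simp add: pole_divisor_def)
      qed
    qed
  qed
qed

lemma semigroup_eq:
  assumes s: "s \<le> r"
  shows "weierstrass_semigroup K F (places s) = pole s ` {z. reg s z}"
proof (intro equalityI subsetI)
  have lp: "length (places s) = s + 1" by (simp add: places_def)
  fix ns
  {
    assume "ns \<in> weierstrass_semigroup K F (places s)"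
    then obtain z where "z \<in> F" "z \<noteq> 0" "length ns = s + 1" "pole_divisor K F z = divisor_of (places s) ns"
      unfolding weierstrass_semigroup_def lp by blast
    then show "ns \<in> pole s ` {z. reg s z}" using pole_divisor_iff[OF s] by blast
  next
    assume "ns \<in> pole s ` {z. reg s z}"
    then obtain z where z: "reg s z" "ns = pole s z" by blast
    then have "z \<in> F" "z \<noteq> 0" "length ns = s + 1" by (auto simp: reg_def length_pole)
    then show "ns \<in> weierstrass_semigroup K F (places s)"
      unfolding weierstrass_semigroup_def lp using pole_divisor_iff[OF s] z by blast
  }
qed

text \<open>Choose a summand that attains the order at the l-th place. At the other places its poles
  can only be smaller, which is the comparison needed for minimality with the l-th entry
  fixed.\<close>

lemma reg_term:
  assumes z: "reg s z" and s: "s \<le> r" and l: "l \<le> s"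
  shows "\<exists>N g i. g \<noteq> 0 \<and> i < m \<and> (\<forall>k\<le>s. ord_at k z \<le> ord_at k (summand s N g i)) \<and> ord_at l z = ord_at l (summand s N g i)"
proof -
  obtain N G where G: "G \<noteq> 0" "degree G < m" "z = ev G / cx (den s) ^ N" using reg_decomp[OF z s] by blast
  obtain i where i: "coeff G i \<noteq> 0" "ord_at l z = ord_at l (summand s N (coeff G i) i)"
    using ord_at_min(2)[OF G(1,2) s l, of N] unfolding G(3) by blast
  have "i < m" using le_degree[OF i(1)] G(2) by simp
  moreover have "ord_at k z \<le> ord_at k (summand s N (coeff G i) i)" if "k \<le> s" for k
    unfolding G(3) using ord_at_min(1)[OF G(1,2) s that i(1)] .
  ultimately show ?thesis using i by blast
qed

text \<open>The exponents are integers because a competitor built in \<open>gamma_eq\<close> lowers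
  one of them by an amount that need not keep it positive.\<close>

definition monomial :: "nat \<Rightarrow> (nat \<Rightarrow> int) \<Rightarrow> nat \<Rightarrow> 'a" where
  "monomial s e i = y ^ i * (\<Prod>k=1..s. (x - emb (\<alpha> k)) powi (- e k))"

lemma linear_nz: "x - emb a \<noteq> 0"
  using cx_eq_0[of "[:- a, 1:]"] by (simp add: cx_linear)

lemma reg_monomial:
  assumes s: "s \<le> r" shows "reg s (monomial s e i)"
  unfolding reg_def
proof (intro conjI allI impI)
  have "x - emb (\<alpha> k) \<in> F" for k using cx_F[of "[:- \<alpha> k, 1:]"] by (simp add: cx_linear)
  then show "monomial s e i \<in> F" unfolding monomial_def
    by (intro subring_mult[OF F_subring] subring_power[OF F_subring] F_gens subring_prod[OF F_subring]
        subfield_powi[OF F_subfield])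
  show "monomial s e i \<noteq> 0" unfolding monomial_def using y_nz linear_nz by simp
  fix R assume V: "val_ring K F R" and R: "R \<notin> RR ` {..s}"
  interpret val_ring K F R by (rule V)
  note u = reg_units[OF V R s]
  show "monomial s e i \<in> R" unfolding monomial_def
    using u by (intro mult power unit_R[OF unit_prod] unit_powi) auto
qed

lemma ord_at_monomial:
  assumes s: "s \<le> r" and k: "k \<le> s"
  shows "ord_at k (monomial s e i) = (if k = 0 then int m * (\<Sum>j=1..s. e j) - int r * int i else int i - int m * e k)"
proof -
  have kr: "k \<le> r" using k s by simp
  interpret val_ring K F "RR k" using val_ring_RR[OF kr] .
  have "has_ord (RR k) (unif k) (monomial s e i)
      (int i * ord_y k + (\<Sum>j=1..s. (- e j) * (if k = 0 then - int m else if j = k then int m else 0)))"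
    unfolding monomial_def using totram_RR[OF kr] s
    by (intro has_ord_mult has_ord_power has_ord_prod has_ord_powi has_ord_linear[OF kr] unif(1)[OF kr])
       (auto simp: totram_def)
  also have "(\<Sum>j=1..s. (- e j) * (if k = 0 then - int m else if j = k then int m else 0))
     = (if k = 0 then int m * (\<Sum>j=1..s. e j) else - int m * e k)"
  proof (cases "k = 0")
    case False
    have "(\<Sum>j=1..s. (- e j) * (if k = 0 then - int m else if j = k then int m else 0))
       = (\<Sum>j=1..s. if j = k then - e j * int m else 0)"
      using False by (intro sum.cong) auto
    then show ?thesis using False k by simp
  qed (simp add: sum_distrib_left mult.commute)
  finally show ?thesis using ord_at_eq[OF kr] by (auto simp: ord_y_def)
qed

text \<open>Since the \<alpha> k are distinct, the sum counts each root of g at most once with its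
  multiplicity.\<close>

lemma sum_order_le: "s \<le> r \<Longrightarrow> g \<noteq> 0 \<Longrightarrow> (\<Sum>k=1..s. order (\<alpha> k) g) \<le> degree g"
proof -
  assume s: "s \<le> r" and g: "g \<noteq> 0"
  have inj: "inj_on \<alpha> {1..s}" using alpha by (rule inj_on_subset) (use s in simp)
  have "(\<Sum>k=1..s. order (\<alpha> k) g) = (\<Sum>a\<in>\<alpha> ` {1..s}. order a g)"
    using inj by (simp add: sum.reindex)
  also have "\<dots> = (\<Sum>a\<in>\<alpha> ` {1..s} \<inter> {a. poly g a = 0}. order a g)"
    by (intro sum.mono_neutral_right) (use order_root g in auto)
  also have "\<dots> \<le> (\<Sum>a | poly g a = 0. order a g)"
    using poly_roots_finite[OF g] by (intro sum_mono2) auto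
  also have "\<dots> \<le> degree g" by (rule sum_order_le_degree[OF g])
  finally show ?thesis .
qed

text \<open>The fixed coordinate is arbitrary in one inclusion, so both infinity and a finite place
  must be treated. In the other inclusion coordinate 0 always works, because the pole order at
  infinity controls both the power of y and the degree.\<close>

lemma gamma_eq:
  assumes s: "1 \<le> s" "s \<le> r"
  shows "minimal_generating_set K F (places s) =
    {a. length a = s + 1 \<and> (\<forall>k\<le>s. 0 < a ! k) \<and>
      (\<exists>(i::nat) (e::nat \<Rightarrow> int). i < m \<and> int (a ! 0) = int r * int i - int m * (\<Sum>k=1..s. e k) \<and>
         (\<forall>k\<in>{1..s}. int (a ! k) = int m * e k - int i))}" (is "?A = ?B")
proof (intro equalityI subsetI)
  fix a assume "a \<in> ?A"
  then obtain l where len: "length a = s + 1" and pos: "\<And>k. k \<le> s \<Longrightarrow> 0 < a ! k" and l: "l \<le> s"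
    and mn: "is_minimal_in a {ns \<in> weierstrass_semigroup K F (places s). ns ! l = a ! l}"
    unfolding minimal_generating_set_def by (auto simp: places_def less_Suc_eq_le)
  have minD: "nat (- ord_at k w) = a ! k"
    if w: "reg s w" and le: "\<And>k. k \<le> s \<Longrightarrow> nat (- ord_at k w) \<le> a ! k" and eq: "nat (- ord_at l w) = a ! l" and k: "k \<le> s"
    for w k
  proof -
    have "pole s w \<in> weierstrass_semigroup K F (places s)"
      unfolding semigroup_eq[OF s(2)] using w by blast
    moreover have "pole s w ! l = a ! l" using eq by (simp only: nth_pole[OF l])
    ultimately have "pole s w \<in> {ns \<in> weierstrass_semigroup K F (places s). ns ! l = a ! l}" by blast
    moreover have "list_all2 (\<le>) (pole s w) a"
      unfolding list_all2_conv_all_nth using le nth_pole by (simp add: length_pole len less_Suc_eq_le)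
    ultimately have "pole s w = a" using mn unfolding is_minimal_in_def by blast
    then show ?thesis using nth_pole[OF k, of w] by simp
  qed
  obtain z where z: "reg s z" "a = pole s z"
    using mn unfolding is_minimal_in_def semigroup_eq[OF s(2)] by auto
  have za: "a ! k = nat (- ord_at k z)" if "k \<le> s" for k using nth_pole[OF that] z by simp
  obtain N g i where g: "g \<noteq> 0" "i < m" and le: "\<And>k. k \<le> s \<Longrightarrow> ord_at k z \<le> ord_at k (summand s N g i)"
    and eq: "ord_at l z = ord_at l (summand s N g i)"
    using reg_term[OF z(1) s(2) l] by blast
  define e where "e k = int N - int (order (\<alpha> k) g)" for k
  \<comment> \<open>The degree of the part of g that is prime to X - \<alpha> k for all k from 1 to
    s.\<close>
  define d where "d = int (degree g) - (\<Sum>k=1..s. int (order (\<alpha> k) g))"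
  have d0: "d \<ge> 0" using sum_order_le[OF s(2) g(1)] unfolding d_def by (metis diff_ge_0_iff_ge of_nat_le_iff of_nat_sum)
  have se: "(\<Sum>k=1..s. e k) = int s * int N - int (degree g) + d"
    unfolding e_def d_def by (simp add: sum_subtractf)
  have "nat (- ord_at k (summand s N g i)) = a ! k" if "k \<le> s" for k
  proof (rule minD[OF reg_summand[OF g(1) s(2)] _ _ that])
    show "nat (- ord_at k' (summand s N g i)) \<le> a ! k'" if "k' \<le> s" for k'
      using le[OF that] za[OF that] by simp
    show "nat (- ord_at l (summand s N g i)) = a ! l" using eq za[OF l] by simp
  qed
  note * = this
  have pa: "int (a ! k) = - ord_at k (summand s N g i)" if "k \<le> s" for k
    using pos[OF that] *[OF that] by linarith
  have ak: "int (a ! k) = int m * e k - int i" if "k \<in> {1..s}" for k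
    using pa[of k] ord_at_summand[OF g(1) s(2), of k N i] that by (simp add: e_def algebra_simps)
  have a0: "int (a ! 0) = int r * int i - int m * (\<Sum>k=1..s. e k) + int m * d"
    using pa[of 0] ord_at_summand[OF g(1) s(2), of 0 N i] unfolding se by (simp add: algebra_simps)
  have "d = 0"
  proof (rule ccontr)
    assume "d \<noteq> 0"
    then have "d \<ge> 1" using d0 by simp
    then have md: "int m * d > 0" using m by simp
    show False
    proof (cases "l = 0")
      case False
      \<comment> \<open>Dropping the prime-to-\<alpha> part of g keeps the orders at the finite
        places and lowers the pole at infinity by m d.\<close>
      have 0: "- ord_at 0 (monomial s e i) = int (a ! 0) - int m * d"
        using a0 ord_at_monomial[OF s(2), of 0 e i] by simp
      have k: "nat (- ord_at k (monomial s e i)) = a ! k" if "k \<in> {1..s}" for k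
        using ak[OF that] ord_at_monomial[OF s(2), of k e i] that by simp
      have le': "nat (- ord_at k (monomial s e i)) \<le> a ! k" if "k \<le> s" for k
        using k[of k] that 0 md by (cases "k = 0") auto
      have l': "nat (- ord_at l (monomial s e i)) = a ! l" using k l False by simp
      have "nat (- ord_at 0 (monomial s e i)) = a ! 0"
        by (rule minD[OF reg_monomial[OF s(2)] le' l']) simp_all
      then show False using 0 md pos[of 0] by simp
    next
      case True
      \<comment> \<open>The pole at infinity must be kept now, so the surplus degree goes into
        powers of x - emb(\<alpha> 1). This lowers the pole at the first finite place by m d, and s
        >= 1 guarantees that this place is listed.\<close>
      define e' where "e' = e(1 := e 1 - d)"
      have se': "(\<Sum>k=1..s. e' k) = (\<Sum>k=1..s. e k) - d"
        using s(1) by (simp add: e'_def sum.atLeast_Suc_atMost)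
      have "- ord_at 0 (monomial s e' i) = int (a ! 0)"
        using a0 ord_at_monomial[OF s(2), of 0 e' i] unfolding se' by (simp add: algebra_simps)
      then have 0: "nat (- ord_at 0 (monomial s e' i)) = a ! 0" by simp
      have 1: "- ord_at 1 (monomial s e' i) = int (a ! 1) - int m * d"
        using ak[of 1] ord_at_monomial[OF s(2), of 1 e' i] s by (simp add: e'_def algebra_simps)
      have k: "nat (- ord_at k (monomial s e' i)) = a ! k" if "k \<in> {2..s}" for k
        using ak[of k] ord_at_monomial[OF s(2), of k e' i] that by (simp add: e'_def)
      have le': "nat (- ord_at k (monomial s e' i)) \<le> a ! k" if ks: "k \<le> s" for k
      proof -
        have "k = 0 \<or> k = 1 \<or> k \<in> {2..s}" using ks by auto
        then consider "k = 0" | "k = 1" | "k \<in> {2..s}" by blast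
        then show ?thesis using 0 1 k md by cases auto
      qed
      have l': "nat (- ord_at l (monomial s e' i)) = a ! l" using 0 True by simp
      have "nat (- ord_at 1 (monomial s e' i)) = a ! 1"
        by (rule minD[OF reg_monomial[OF s(2)] le' l']) (use s in simp_all)
      then show False using 1 md pos[of 1] s by simp
    qed
  qed
  then show "a \<in> ?B" using len pos a0 ak g(2) by auto
next
  fix a assume "a \<in> ?B"
  then obtain i e where len: "length a = s + 1" and pos: "\<And>k. k \<le> s \<Longrightarrow> 0 < a ! k" and i: "i < m"
    and a0: "int (a ! 0) = int r * int i - int m * (\<Sum>k=1..s. e k)"
    and ak: "\<And>k. k \<in> {1..s} \<Longrightarrow> int (a ! k) = int m * e k - int i" by blast
  have pm: "nat (- ord_at k (monomial s e i)) = a ! k" if "k \<le> s" for k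
    using a0 ak[of k] ord_at_monomial[OF s(2) that, of e i] that by (cases "k = 0") auto
  have "pole s (monomial s e i) = a"
    by (rule nth_equalityI) (auto simp: length_pole len nth_pole pm less_Suc_eq_le)
  then have aH: "a \<in> weierstrass_semigroup K F (places s)"
    unfolding semigroup_eq[OF s(2)] using reg_monomial[OF s(2), of e i] by blast
  have "b = a" if b: "b \<in> weierstrass_semigroup K F (places s)" "b ! 0 = a ! 0" "list_all2 (\<le>) b a" for b
  proof -
    obtain z where z: "reg s z" "b = pole s z" using b(1) unfolding semigroup_eq[OF s(2)] by auto
    have bz: "b ! k = nat (- ord_at k z)" if "k \<le> s" for k using nth_pole[OF that] z by simp
    have ba: "b ! k \<le> a ! k" if "k \<le> s" for k
      using b(3) that unfolding list_all2_conv_all_nth by (simp add: len)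
    obtain N g i' where g: "g \<noteq> 0" "i' < m" and le: "\<And>k. k \<le> s \<Longrightarrow> ord_at k z \<le> ord_at k (summand s N g i')"
      and eq: "ord_at 0 z = ord_at 0 (summand s N g i')"
      using reg_term[OF z(1) s(2), of 0] by blast
    \<comment> \<open>Positivity of the entry rules out that \<open>nat\<close> has truncated
      anything.\<close>
    have "int (a ! 0) = - ord_at 0 (summand s N g i')" using bz[of 0] b(2) eq pos[of 0] by simp
    then have 0: "int r * int i - int m * (\<Sum>k=1..s. e k) = int m * int (degree g) + int r * int i' - int m * int s * int N"
      using ord_at_summand[OF g(1) s(2), of 0 N i'] a0 by simp
    then have "int r * (int i - int i') = int m * (int (degree g) - int s * int N + (\<Sum>k=1..s. e k))"
      by (simp add: algebra_simps)
    then have "int m dvd int r * (int i - int i')" by simp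
    then have "int m dvd int i - int i'" using mr by (simp add: coprime_dvd_mult_right_iff)
    then have "int i mod int m = int i' mod int m" by (simp add: mod_eq_dvd_iff)
    then have ii: "i' = i" using g(2) i by simp
    define c where "c k = int N - int (order (\<alpha> k) g)" for k
    have pt: "- ord_at k (summand s N g i') = int m * c k - int i" if "k \<in> {1..s}" for k
      using ord_at_summand[OF g(1) s(2), of k N i'] that by (simp add: ii c_def algebra_simps)
    have ce: "c k \<le> e k" if k: "k \<in> {1..s}" for k
    proof -
      have "- ord_at k (summand s N g i') \<le> int (b ! k)" using bz[of k] le[of k] k by simp
      also have "\<dots> \<le> int (a ! k)" using ba[of k] k by simp
      finally have "int m * c k \<le> int m * e k" using pt[OF k] ak[OF k] by simp
      then show ?thesis using m by simp
    qed
    \<comment> \<open>Equality at infinity fixes the degree of g, hence the sum of the c k is at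
      least that of the e k; as c k <= e k for each k, all of them agree.\<close>
    have "int m * (\<Sum>k=1..s. e k) = int m * (int s * int N - int (degree g))"
      using 0 ii by (simp add: algebra_simps)
    then have "(\<Sum>k=1..s. e k) = int s * int N - int (degree g)" using m by simp
    also have "\<dots> \<le> int s * int N - int (\<Sum>k=1..s. order (\<alpha> k) g)"
      using sum_order_le[OF s(2) g(1)] by (simp del: of_nat_sum)
    also have "\<dots> = (\<Sum>k=1..s. c k)" by (simp add: c_def sum_subtractf)
    finally have "(\<Sum>k=1..s. c k) = (\<Sum>k=1..s. e k)" using sum_mono[of "{1..s}" c e] ce by simp
    then have cek: "c k = e k" if "k \<in> {1..s}" for k using sum_mono_inv[of c "{1..s}" e k] ce that by simp
    show "b = a"
    proof (rule nth_equalityI)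
      show "length b = length a" using z by (simp add: length_pole len)
      fix k assume "k < length b"
      then have k: "k \<le> s" using z by (simp add: length_pole)
      show "b ! k = a ! k"
      proof (cases "k = 0")
        case False
        then have "k \<in> {1..s}" using k by simp
        then have "int (a ! k) = - ord_at k (summand s N g i')" using pt cek ak by simp
        also have "\<dots> \<le> int (b ! k)" using bz[OF k] le[OF k] by simp
        finally show ?thesis using ba[OF k] by simp
      qed (use b in simp)
    qed
  qed
  then have "is_minimal_in a {ns \<in> weierstrass_semigroup K F (places s). ns ! 0 = a ! 0}"
    unfolding is_minimal_in_def using aH by blast
  then show "a \<in> ?A" unfolding minimal_generating_set_def using len pos by (auto simp: places_def)
qed

end

text \<open>Positive entries force m e k > i >= 0, so e k >= 1, and then positivity at infinity
  gives m s < r i. Inserting i <= m - 1 leaves m s + r < m r. The bound on \<open>i\<close> bounds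
  the other parametrization, and the bound on \<open>s\<close> makes the set empty for large
  s.\<close>

lemma monomial_exponents_bounds:
  fixes a :: "nat list" and e :: "nat \<Rightarrow> int" and i m r s :: nat
  assumes m: "m > 0" and pos: "\<And>k. k \<le> s \<Longrightarrow> 0 < a ! k" and i: "i < m"
    and a0: "int (a ! 0) = int r * int i - int m * (\<Sum>k=1..s. e k)"
    and ak: "\<And>k. k \<in> {1..s} \<Longrightarrow> int (a ! k) = int m * e k - int i"
  shows "k \<in> {1..s} \<Longrightarrow> 1 \<le> e k" and "m * s < r * i" and "s + r div m < r"
proof -
  show e: "1 \<le> e k" if "k \<in> {1..s}" for k
  proof -
    have "0 < int m * e k" using ak[OF that] pos[of k] that by simp
    then show ?thesis using m by (simp add: zero_less_mult_iff)
  qed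
  have "int s = (\<Sum>k=1..s. 1)" by simp
  also have "\<dots> \<le> (\<Sum>k=1..s. e k)" using e by (intro sum_mono) auto
  finally have "int m * int s \<le> int m * (\<Sum>k=1..s. e k)" by (intro mult_left_mono) auto
  then have "int (m * s) < int (r * i)" using a0 pos[of 0] by simp
  then show ms: "m * s < r * i" by (simp only: of_nat_less_iff)
  also have "r * i \<le> r * (m - 1)" using i by (intro mult_left_mono) auto
  also have "\<dots> = m * r - r" by (simp add: diff_mult_distrib2 mult.commute)
  finally have *: "m * s + r < m * r" by simp
  have "m * (s + r div m) \<le> m * s + r" by (simp add: distrib_left)
  then have "m * (s + r div m) < m * r" using * by (rule le_less_trans)
  then show "s + r div m < r" by (simp only: mult_less_cancel1)
qed

text \<open>The substitution \<open>i \<mapsto> m - i\<close>, \<open>j\<^sub>k = e\<^sub>k - 1\<close>.\<close>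

lemma exponents_iff:
  fixes a :: "nat list" and m r s :: nat
  assumes m: "m > 0" and r: "r > 0" and s: "1 \<le> s" and pos: "\<And>k. k \<le> s \<Longrightarrow> 0 < a ! k"
  shows "(\<exists>(i::nat) (e::nat \<Rightarrow> int). i < m \<and> int (a ! 0) = int r * int i - int m * (\<Sum>k=1..s. e k) \<and>
         (\<forall>k\<in>{1..s}. int (a ! k) = int m * e k - int i)) \<longleftrightarrow>
     (\<exists>(i::int) (j::nat \<Rightarrow> int).
         1 \<le> i \<and> i \<le> int m - 1 - \<lfloor>real m / real r\<rfloor> \<and>
         j 0 \<ge> \<lceil>real_of_int i * real r / real m\<rceil> \<and>
         (\<forall>k\<in>{1..s}. 0 \<le> j k) \<and>
         (\<Sum>k=0..s. j k) = int r - int s \<and>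
         int (a ! 0) = int m * j 0 - i * int r \<and>
         (\<forall>k\<in>{1..s}. int (a ! k) = int m * j k + i))" (is "?L \<longleftrightarrow> ?R")
proof
  assume ?L
  then obtain i :: nat and e :: "nat \<Rightarrow> int" where i: "i < m"
    and a0: "int (a ! 0) = int r * int i - int m * (\<Sum>k=1..s. e k)"
    and ak: "\<And>k. k \<in> {1..s} \<Longrightarrow> int (a ! k) = int m * e k - int i" by blast
  have bounds: "\<And>k. k \<in> {1..s} \<Longrightarrow> 1 \<le> e k" "m * s < r * i"
    by (rule monomial_exponents_bounds[OF m pos i a0 ak]; assumption)+
  define i' where "i' = int m - int i"
  \<comment> \<open>The value at 0 is what the prescribed total r - s leaves after the e k - 1 are
    subtracted.\<close>
  define j where "j k = (if k = 0 then int r - (\<Sum>k=1..s. e k) else e k - 1)" for k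
  have i1: "1 \<le> i'" using i by (simp add: i'_def)
  \<comment> \<open>This chain uses s >= 1 and ends in m div r < i, which is the required upper
    bound for i' = m - i.\<close>
  have "r * (m div r) \<le> m" by simp
  also have "m \<le> m * s" using s by simp
  also have "m * s < r * i" by (rule bounds(2))
  finally have "m div r < i" using r by simp
  then have i2: "i' \<le> int m - 1 - \<lfloor>real m / real r\<rfloor>"
    by (simp add: i'_def floor_divide_of_nat_eq)
  have a0': "int (a ! 0) = int m * j 0 - i' * int r"
    using a0 by (simp add: j_def i'_def algebra_simps)
  then have "i' * int r < int m * j 0" using pos[of 0] by simp
  then have "real_of_int (i' * int r) \<le> real_of_int (int m * j 0)" by (simp only: of_int_le_iff less_imp_le)
  then have "real_of_int i' * real r / real m \<le> real_of_int (j 0)"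
    using m by (simp add: pos_divide_le_eq mult.commute)
  then have j0: "j 0 \<ge> \<lceil>real_of_int i' * real r / real m\<rceil>" by (simp add: ceiling_le_iff)
  have jk: "0 \<le> j k" if "k \<in> {1..s}" for k using bounds(1)[OF that] that by (simp add: j_def)
  have "(\<Sum>k=1..s. j k) = (\<Sum>k=1..s. e k - 1)" by (intro sum.cong) (auto simp: j_def)
  also have "\<dots> = (\<Sum>k=1..s. e k) - int s" by (simp add: sum_subtractf)
  finally have "(\<Sum>k=0..s. j k) = int r - int s"
    by (simp add: sum.atLeast_Suc_atMost j_def)
  moreover have "int (a ! k) = int m * j k + i'" if "k \<in> {1..s}" for k
    using ak[OF that] that by (simp add: j_def i'_def algebra_simps)
  ultimately show ?R using i1 i2 j0 jk a0' by blast
next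
  assume ?R
  then obtain i :: int and j :: "nat \<Rightarrow> int" where i: "1 \<le> i" "i \<le> int m - 1 - \<lfloor>real m / real r\<rfloor>"
    and sj: "(\<Sum>k=0..s. j k) = int r - int s" and a0: "int (a ! 0) = int m * j 0 - i * int r"
    and ak: "\<And>k. k \<in> {1..s} \<Longrightarrow> int (a ! k) = int m * j k + i" by blast
  define e where "e k = j k + 1" for k
  define i' where "i' = nat (int m - i)"
  have "i \<le> int m" using i(2) by (simp add: floor_divide_of_nat_eq)
  then have i': "int i' = int m - i" "i' < m" using i(1) by (auto simp: i'_def)
  have se: "(\<Sum>k=1..s. e k) = int r - j 0" using sj by (simp add: e_def sum.distrib sum.atLeast_Suc_atMost)
  have "int (a ! 0) = int r * int i' - int m * (\<Sum>k=1..s. e k)"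
    unfolding se i'(1) using a0 by (simp add: algebra_simps)
  moreover have "int (a ! k) = int m * e k - int i'" if "k \<in> {1..s}" for k
    using ak[OF that] by (simp add: e_def i' algebra_simps)
  ultimately show ?L using i'(2) by blast
qed

text \<open>
  As \<open>\<lambda>\<close> is invertible modulo \<open>m\<close>, the curve can be rewritten as \<open>y\<^sub>0\<^sup>m = \<Prod>\<^sub>i (x - \<alpha>\<^sub>i)\<close>.
\<close>

lemma exists_normalized_generator:
  fixes y w :: "'a::field" and lam :: int and m :: nat
  assumes cop: "gcd lam (int m) = 1" and m: "m > 0" and w: "w \<noteq> 0" and y: "y ^ m = w powi lam"
  obtains u v y0 where "y0 = y powi u * w powi v" "y0 ^ m = w" "y = y0 powi lam"
proof -
  obtain u v where uv: "u * lam + v * int m = 1" using bezout_int[of lam "int m"] cop by metis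
  \<comment> \<open>Formally y is w^(lam/m), and 1/m = u * lam/m + v, so this product is an m-th
    root of w inside the field.\<close>
  define y0 where "y0 = y powi u * w powi v"
  have y_nz: "y \<noteq> 0" using y w m by (auto simp: power_0_left)
  have "y0 ^ m = (y ^ m) powi u * w powi (v * int m)"
    unfolding y0_def power_mult_distrib by (simp add: power_int_power power_int_power' mult.commute)
  also have "\<dots> = w powi (u * lam + v * int m)"
    using w by (simp add: y power_int_add mult.commute flip: power_int_mult)
  finally have 1: "y0 ^ m = w" by (simp add: uv)
  have "y0 powi lam = y powi (u * lam) * w powi (v * lam)"
    unfolding y0_def power_int_mult_distrib by (simp add: power_int_mult)
  also have "w powi (v * lam) = (w powi lam) powi v" by (metis mult.commute power_int_mult)
  also have "\<dots> = y powi (v * int m)"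
    by (simp add: y[symmetric] power_int_power mult.commute)
  also have "y powi (u * lam) * y powi (v * int m) = y"
    using y_nz uv by (simp flip: power_int_add)
  finally show ?thesis using that y0_def 1 by metis
qed

theorem proposition5p2:
  fixes emb :: "'k::{field,finite} \<Rightarrow> 'a::field"
    and K Kx F Qinf :: "'a set" and Q :: "nat \<Rightarrow> 'a set"
    and x y :: 'a and \<alpha> :: "nat \<Rightarrow> 'k"
    and q m r :: nat and lam :: int
  assumes q: "primepow q" "card (UNIV :: 'k set) = q"
    and m: "m \<ge> 2" and r: "r \<ge> 2"
    and lam: "lam \<noteq> 0" "gcd (int r * lam) (int m) = 1"
    and mq: "gcd m q = 1"
    and alpha: "inj_on \<alpha> {1..r}"
    and emb: "is_ring_hom emb" and K: "K = range emb"
    and x: "transcendental_over emb x" and Kx: "Kx = field_generated (K \<union> {x})"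
    and y: "y ^ m = (\<Prod>i=1..r. (x - emb (\<alpha> i)) powi lam)"
    and F: "F = field_generated (K \<union> {x, y})"
    and Qinf: "is_place K F Qinf"
      "\<exists>P. is_place K Kx P \<and> place_val Kx P x < 0 \<and> lies_over Qinf P"
    and Q: "\<And>i. i \<in> {1..r} \<Longrightarrow> is_place K F (Q i)"
      "\<And>i. i \<in> {1..r} \<Longrightarrow>
         \<exists>P. is_place K Kx P \<and> place_val Kx P (x - emb (\<alpha> i)) > 0 \<and> lies_over (Q i) P"
    and rq: "r + 1 \<le> q"
  shows "(\<forall>s::nat. 1 \<le> s \<and> int s \<le> int r - \<lfloor>real r / real m\<rfloor> - 1 \<longrightarrow>
            minimal_generating_set K F (Qinf # map Q [1..<s+1]) =
              {a. length a = s + 1 \<and> (\<forall>k\<le>s. 0 < a ! k) \<and>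
                  (\<exists>(i::int) (j::nat \<Rightarrow> int).
                     1 \<le> i \<and> i \<le> int m - 1 - \<lfloor>real m / real r\<rfloor> \<and>
                     j 0 \<ge> \<lceil>real_of_int i * real r / real m\<rceil> \<and>
                     (\<forall>k\<in>{1..s}. 0 \<le> j k) \<and>
                     (\<Sum>k=0..s. j k) = int r - int s \<and>
                     int (a ! 0) = int m * j 0 - i * int r \<and>
                     (\<forall>k\<in>{1..s}. int (a ! k) = int m * j k + i))}) \<and>
         (\<forall>s::nat. int r - \<lfloor>real r / real m\<rfloor> - 1 < int s \<and> s \<le> r \<longrightarrow>
            minimal_generating_set K F (Qinf # map Q [1..<s+1]) = {})"
proof -
  define f where "f = (\<Prod>i=1..r. [:- \<alpha> i, 1:])"
  define w where "w = poly (map_poly emb f) x"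
  note hom = is_ring_hom_eval[OF emb, of x]
  have lin: "poly (map_poly emb [:- \<alpha> i, 1:]) x = x - emb (\<alpha> i)" for i
    by (simp add: map_poly_pCons hom_zero[OF emb] hom_uminus[OF emb] hom_one[OF emb])
  have w_prod: "w = (\<Prod>i=1..r. x - emb (\<alpha> i))"
    unfolding w_def f_def hom_prod[OF hom] lin ..
  have f_nz: "f \<noteq> 0" by (simp add: f_def)
  have w_nz: "w \<noteq> 0" using x f_nz unfolding transcendental_over_def w_def by blast
  have cop_r: "coprime m r" and cop_lam: "gcd lam (int m) = 1"
  proof -
    have "coprime (int r * lam) (int m)" using lam(2) by (simp add: coprime_iff_gcd_eq_1)
    then have "coprime r m" and c: "coprime lam (int m)" by simp_all
    then show "coprime m r" by (simp only: coprime_commute)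
    show "gcd lam (int m) = 1" using c by (rule coprime_imp_gcd_eq_1)
  qed
  have cop_q: "coprime m (card (UNIV :: 'k set))" by (simp only: coprime_iff_gcd_eq_1 q(2) mq)
  have pow: "(\<Prod>i\<in>I. g i) powi lam = (\<Prod>i\<in>I. g i powi lam)" for g :: "nat \<Rightarrow> 'a" and I
    by (induction I rule: infinite_finite_induct) (auto simp: power_int_mult_distrib)
  have yw: "y ^ m = w powi lam" unfolding w_prod pow y ..
  have m0: "m > 0" and r0: "r > 0" using m r by auto
  obtain u v y0 where y0: "y0 = y powi u * w powi v" "y0 ^ m = w" "y = y0 powi lam"
    using exists_normalized_generator[OF cop_lam m0 w_nz yw] .
  interpret k0: kummer0 emb x y0 \<alpha> m r f
    by unfold_locales (use f_def emb x m0 r0 cop_r cop_q alpha y0(2) w_def in auto)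
  \<comment> \<open>The rational function field is the case \<open>m = 1\<close>.\<close>
  interpret c0: kummer0 emb x w \<alpha> 1 r f
    by unfold_locales (use f_def emb x r0 alpha w_def in auto)
  interpret c: kummer emb x w \<alpha> 1 r f
  proof
    fix G :: "'k poly poly" assume "G \<noteq> 0" "degree G < 1"
    then obtain g where "G = [:g:]" "g \<noteq> 0" by (auto elim: degree_eq_zeroE)
    then show "c0.ev G \<noteq> 0" by (simp add: c0.ev_const c0.cx_eq_0)
  qed
  have KxF: "c0.F = Kx"
  proof
    have "w \<in> Kx" unfolding w_prod Kx K
      using field_generated_incl[of "range emb \<union> {x}"] is_subfield_field_generated[of "range emb \<union> {x}"]
      by (intro subring_prod subring_diff) (auto simp: is_subfield_def)
    then show "c0.F \<subseteq> Kx"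
      using field_generated_incl[of "K \<union> {x}"] is_subfield_field_generated[of "K \<union> {x}"]
      by (intro field_generated_least) (auto simp: Kx K)
    show "Kx \<subseteq> c0.F" unfolding Kx K
      using c0.F_gens by (intro field_generated_least[OF c0.F_subfield]) auto
  qed
  have FF: "k0.F = F"
  proof
    have sF: "is_subfield F" unfolding F by (rule is_subfield_field_generated)
    have gF: "K \<union> {x, y} \<subseteq> F" unfolding F by (rule field_generated_incl)
    have "w \<in> F" unfolding w_prod using gF sF K
      by (intro subring_prod subring_diff) (auto simp: is_subfield_def)
    then have "y0 \<in> F" unfolding y0(1) using gF sF
      by (intro subring_mult subfield_powi) (auto simp: is_subfield_def)
    then show "k0.F \<subseteq> F" using gF sF K by (intro field_generated_least) auto
    have "y \<in> k0.F" unfolding y0(3) using k0.F_gens k0.F_subfield by (intro subfield_powi) auto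
    then show "F \<subseteq> k0.F" unfolding F K
      using k0.F_gens by (intro field_generated_least[OF k0.F_subfield]) auto
  qed
  define QQ where "QQ k = (if k = 0 then Qinf else Q k)" for k
  define RR where "RR k = place_ring F (QQ k)" for k
  have V: "val_ring K F (RR k) \<and> QQ k = val_ring.P (RR k)" if "k \<le> r" for k
  proof -
    have "is_place K F (QQ k)" using Qinf(1) Q(1)[of k] that by (simp add: QQ_def)
    then obtain R where "val_ring K F R" "QQ k = val_ring.P R" "place_ring F (QQ k) = R"
      using place_val_ring k0.F_subfield FF by metis
    then show ?thesis by (simp add: RR_def)
  qed
  have x0: "x \<notin> RR 0"
  proof
    assume xR: "x \<in> RR 0"
    obtain P where P: "is_place K Kx P" "place_val Kx P x < 0" "P \<subseteq> Qinf"
      using Qinf(2) unfolding lies_over_def by blast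
    obtain R where R: "val_ring K Kx R" "P = val_ring.P R"
      using place_val_ring[OF _ P(1)] c0.F_subfield KxF by metis
    have "x \<noteq> 0" using c0.cx_X c0.cx_eq_0[of "[:0, 1:]"] by auto
    moreover have "x \<in> Kx" using c0.F_gens(2) KxF by simp
    \<comment> \<open>The sign of \<open>place_val\<close> turns into membership because the places
      of K(x) are discrete, which the interpretation with m = 1 provides.\<close>
    ultimately have "x \<notin> R" using c.place_val_ring_iff(1)[of R x] R P(2) KxF K by auto
    then have "inverse x \<in> Qinf" using val_ring.inverse_P[OF R(1) \<open>x \<in> Kx\<close>] R(2) P(3) by blast
    then have ix: "inverse x \<in> val_ring.P (RR 0)" using V[of 0] by (simp add: QQ_def)
    interpret val_ring K F "RR 0" using V[of 0] by simp
    show False using P_mult[OF xR ix] P_one \<open>x \<noteq> 0\<close> by simp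
  qed
  have xk: "x - emb (\<alpha> k) \<in> val_ring.P (RR k)" if k: "k \<in> {1..r}" for k
  proof -
    obtain P where P: "is_place K Kx P" "place_val Kx P (x - emb (\<alpha> k)) > 0" "P \<subseteq> Q k"
      using Q(2)[OF k] unfolding lies_over_def by blast
    obtain R where R: "val_ring K Kx R" "P = val_ring.P R"
      using place_val_ring[OF _ P(1)] c0.F_subfield KxF by metis
    have "x - emb (\<alpha> k) = c0.cx [:- \<alpha> k, 1:]" by (simp add: c0.cx_linear)
    then have "x - emb (\<alpha> k) \<noteq> 0" "x - emb (\<alpha> k) \<in> Kx"
      using c0.cx_eq_0[of "[:- \<alpha> k, 1:]"] c0.cx_F KxF by auto
    then have "x - emb (\<alpha> k) \<in> P" using c.place_val_ring_iff(2)[of R "x - emb (\<alpha> k)"] R P(2) KxF K by auto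
    then show ?thesis using P(3) V[of k] k by (auto simp: QQ_def)
  qed
  \<comment> \<open>Total ramification at the first finite place supplies the independence of the
    powers of \<open>y0\<close> over K(x) for the next interpretation.\<close>
  have tr: "k0.totram (RR 1) y0 (\<lambda>g. int (order (\<alpha> 1) g)) 1"
    using k0.totram_finite[of "RR 1" 1] V[of 1] xk[of 1] r0 FF K by simp
  interpret k: kummer emb x y0 \<alpha> m r f
    by unfold_locales (rule k0.totram_indep[OF tr])
  have V': "val_ring k0.K k0.F (RR k)" if "k \<le> r" for k using V[OF that] FF K by simp
  interpret kummer_places emb x y0 \<alpha> m r f RR
    by (intro kummer_places.intro k.kummer_axioms kummer_places_axioms.intro V' x0 xk) (auto simp: f_def)
  have places: "Qinf # map Q [1..<s+1] = places s" if s: "s \<le> r" for s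
  proof -
    have "places s = map QQ [0..<s+1]" unfolding places_def using V s by (intro map_cong) auto
    also have "\<dots> = QQ 0 # map QQ [1..<s+1]" by (simp add: upt_conv_Cons del: upt_Suc)
    also have "\<dots> = Qinf # map Q [1..<s+1]" by (auto simp: QQ_def)
    finally show ?thesis ..
  qed
  have gamma: "minimal_generating_set K F (Qinf # map Q [1..<s+1]) =
      {a. length a = s + 1 \<and> (\<forall>k\<le>s. 0 < a ! k) \<and>
      (\<exists>(i::nat) (e::nat \<Rightarrow> int). i < m \<and> int (a ! 0) = int r * int i - int m * (\<Sum>k=1..s. e k) \<and>
         (\<forall>k\<in>{1..s}. int (a ! k) = int m * e k - int i))}" if "1 \<le> s" "s \<le> r" for s
    using gamma_eq[OF that] unfolding places[OF that(2)] FF K .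
  have fl: "\<lfloor>real r / real m\<rfloor> = int (r div m)" by (rule floor_divide_of_nat_eq)
  have less: "r div m < r" using m r0 by simp
  show ?thesis
  proof (intro conjI allI impI)
    fix s :: nat assume s: "1 \<le> s \<and> int s \<le> int r - \<lfloor>real r / real m\<rfloor> - 1"
    then have s': "1 \<le> s" "s \<le> r" unfolding fl by auto
    show "minimal_generating_set K F (Qinf # map Q [1..<s+1]) =
              {a. length a = s + 1 \<and> (\<forall>k\<le>s. 0 < a ! k) \<and>
                  (\<exists>(i::int) (j::nat \<Rightarrow> int).
                     1 \<le> i \<and> i \<le> int m - 1 - \<lfloor>real m / real r\<rfloor> \<and>
                     j 0 \<ge> \<lceil>real_of_int i * real r / real m\<rceil> \<and>
                     (\<forall>k\<in>{1..s}. 0 \<le> j k) \<and>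
                     (\<Sum>k=0..s. j k) = int r - int s \<and>
                     int (a ! 0) = int m * j 0 - i * int r \<and>
                     (\<forall>k\<in>{1..s}. int (a ! k) = int m * j k + i))}"
      unfolding gamma[OF s'] by (intro Collect_cong conj_cong refl exponents_iff[OF m0 r0 s'(1)]) blast
  next
    fix s :: nat assume s: "int r - \<lfloor>real r / real m\<rfloor> - 1 < int s \<and> s \<le> r"
    then have s1: "r \<le> s + r div m" unfolding fl by simp
    then have s': "1 \<le> s" "s \<le> r" using s less by auto
    show "minimal_generating_set K F (Qinf # map Q [1..<s+1]) = {}"
      unfolding gamma[OF s']
    proof (rule equals0I, elim CollectE conjE exE)
      fix a :: "nat list" and i :: nat and e :: "nat \<Rightarrow> int"
      assume a: "\<forall>k\<le>s. 0 < a ! k" "i < m" "int (a ! 0) = int r * int i - int m * (\<Sum>k=1..s. e k)"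
        "\<forall>k\<in>{1..s}. int (a ! k) = int m * e k - int i"
      have "s + r div m < r"
        by (rule monomial_exponents_bounds(3)[OF m0 _ a(2,3)]) (use a in auto)
      then show False using s1 by simp
    qed
  qed
qed

end
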